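(* Let $C: f=0$ be a reduced plane curve of degree $d$ in $\mathbb{P}^2$ (over $\mathbb{C}$) which is a $3$-syzygy curve with exponents $d_1\le d_2\le d_3$ (where $d_1\ge 1$), and which is not plus-one generated. Set $e=d_1+d_2+d_3$ and $k_i=2(d-1)-d_i$ for $i=1,2,3$. Let $\sigma=\sigma(C)=3(d-1)-e$ and $$T_0=\begin{cases} k_1-1 & \text{if } d_1\ge \frac d2,\\ d+d_1-2 & \text{if } d_1<\frac d2.\end{cases}$$ Then, for integers $k$, $$n(f)_k=\begin{cases} 0 & \text{for } k<\sigma,\\ \binom{k-\sigma+2}{2} & \text{for } \sigma\le k<k_3,\\ \binom{k-\sigma+2}{2}-\binom{k-k_3+2}{2} & \text{for } k_3\le k<k_2,\\ \binom{k-\sigma+2}{2}-\binom{k-k_3+2}{2}-\binom{k-k_2+2}{2} & \text{for } k_2\le k<T_0.\end{cases}$$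
   Context: Let $S=\mathbb{C}[x,y,z]$ with its standard grading and maximal ideal $\mathbf m=(x,y,z)$. For a reduced curve $C:f=0$ of degree $d$ in the complex projective plane $\mathbb{P}^2$, with $f\in S$ homogeneous of degree $d$, let $J_f=(f_x,f_y,f_z)\subset S$ be the ideal generated by the partial derivatives of $f$, and let $\hat J_f$ be the saturation of $J_f$ with respect to $\mathbf m$. The Jacobian module is the graded $S$-module $N(f)=\hat J_f/J_f$; put $n(f)_j=\dim_{\mathbb{C}} N(f)_j$ and $\sigma(C)=\min\{j: n(f)_j\ne 0\}$. The graded module of Jacobian syzygies is $\mathrm{Syz}(J_f)=\{(a,b,c)\in S^3: af_x+bf_y+cf_z=0\}$, where $(a,b,c)$ has degree $k$ if $a,b,c\in S_k$. The curve $C$ is an $m$-syzygy curve if $\mathrm{Syz}(J_f)$ is minimally generated by $m$ homogeneous syzygies $r_1,\dots,r_m$, of degrees $d_i=\deg r_i$ ordered so that $1\le d_1\le\dots\le d_m$; the multiset $(d_1,\dots,d_m)$ is called the exponents of $C$. A $3$-syzygy curve is plus-one generated (of level $d_3$) if $d_1+d_2=d$ and $d_3\ge d_2$. *)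

theory Defs
  imports
    "HOL-Library.Poly_Mapping"
    "HOL-Library.Numeral_Type"
    "HOL-Computational_Algebra.Squarefree"
    "HOL-Analysis.Finite_Cartesian_Product"
begin

section \<open>Dimension of a quotient of subspaces\<close>

locale vector_space_quotient = vector_space scale
  for scale :: "'a::field \<Rightarrow> 'b::ab_group_add \<Rightarrow> 'b" (infixr \<open>*c\<close> 75)
begin

text \<open>The classes of the elements of \<open>B\<close> form a (finite) basis of \<open>V / W\<close>: every class is the
  class of exactly one linear combination of elements of \<open>B\<close>. The coefficients are normalised to
  vanish outside \<open>B\<close> so that they are determined as a function.\<close>

definition quotient_basis :: "'b set \<Rightarrow> 'b set \<Rightarrow> 'b set \<Rightarrow> bool" where
  "quotient_basis V W B \<longleftrightarrow>
     finite B \<and> B \<subseteq> V \<and>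
     (\<forall>v\<in>V. \<exists>!c. (\<forall>b. b \<notin> B \<longrightarrow> c b = 0) \<and> v - (\<Sum>b\<in>B. c b *c b) \<in> W)"

text \<open>Only used when \<open>W \<subseteq> V\<close> are subspaces and \<open>V\<close> is finite-dimensional; see
  \<open>quotient_dim_add\<close> below.\<close>

definition quotient_dim :: "'b set \<Rightarrow> 'b set \<Rightarrow> nat" where
  "quotient_dim V W = (THE n. \<exists>B. quotient_basis V W B \<and> card B = n)"

lemma quotient_basis_independent:
  assumes W: "subspace W" and B: "quotient_basis V W B" and "0 \<in> V"
    and u: "(\<Sum>b\<in>B. u b *c b) \<in> W" and b: "b \<in> B"
  shows "u b = 0"
proof -
  define P where "P c \<longleftrightarrow> (\<forall>b. b \<notin> B \<longrightarrow> c b = 0) \<and> 0 - (\<Sum>b\<in>B. c b *c b) \<in> W" for c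
  define u' where "u' = (\<lambda>b. if b \<in> B then u b else 0)"
  have ex1: "\<exists>!c. P c"
    using B \<open>0 \<in> V\<close> unfolding quotient_basis_def P_def by blast
  have zero: "P (\<lambda>_. 0)"
    using subspace_0[OF W] by (simp add: P_def)
  have "(\<Sum>b\<in>B. u' b *c b) = (\<Sum>b\<in>B. u b *c b)"
    by (rule sum.cong) (auto simp: u'_def)
  then have "P u'"
    using subspace_neg[OF W u] by (simp add: P_def u'_def)
  from the1_equality[OF ex1, OF this] the1_equality[OF ex1, OF zero] have "u' = (\<lambda>_. 0)"
    by simp
  then have "u' b = 0"
    by simp
  then show ?thesis
    using b by (simp add: u'_def)
qed

lemma quotient_basis_card:
  assumes V: "subspace V" and W: "subspace W" and WV: "W \<subseteq> V"
    and fin: "finite C" and C: "independent C" "span C = W"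
    and B: "quotient_basis V W B"
  shows "card B + card C = dim V"
proof -
  have finB: "finite B" and BV: "B \<subseteq> V"
    using B by (auto simp: quotient_basis_def)
  have V0: "0 \<in> V"
    using subspace_0[OF V] .
  note ind = quotient_basis_independent[OF W B V0]
  have disj: "B \<inter> C = {}"
  proof (rule ccontr)
    assume "B \<inter> C \<noteq> {}"
    then obtain b where b: "b \<in> B" "b \<in> C" by blast
    have "(\<Sum>x\<in>B. (if x = b then 1 else 0) *c x) = (\<Sum>x\<in>B. if x = b then b else 0)"
      by (rule sum.cong) auto
    also have "\<dots> = b"
      using b finB by simp
    finally have "(\<Sum>x\<in>B. (if x = b then 1 else 0) *c x) \<in> W"
      using b(2) C(2) span_base by force
    from ind[OF this b(1)] show False by simp
  qed
  have "independent (B \<union> C)"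
  proof
    assume "dependent (B \<union> C)"
    then obtain u v where v: "v \<in> B \<union> C" "u v \<noteq> 0" and "(\<Sum>x\<in>B \<union> C. u x *c x) = 0"
      using finB fin by (auto simp: dependent_finite)
    then have s: "(\<Sum>x\<in>B. u x *c x) + (\<Sum>x\<in>C. u x *c x) = 0"
      using finB fin disj by (simp add: sum.union_disjoint)
    have "(\<Sum>x\<in>C. u x *c x) \<in> W"
      using C(2) by (blast intro: span_sum span_scale span_base)
    then have "- (\<Sum>x\<in>C. u x *c x) \<in> W"
      by (rule subspace_neg[OF W])
    moreover have "- (\<Sum>x\<in>C. u x *c x) = (\<Sum>x\<in>B. u x *c x)"
      using s[folded eq_neg_iff_add_eq_0] by (rule sym)
    ultimately have uB: "\<And>b. b \<in> B \<Longrightarrow> u b = 0"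
      using ind[of u] by simp
    then have "(\<Sum>x\<in>C. u x *c x) = 0"
      using s by simp
    then have "\<And>c. c \<in> C \<Longrightarrow> u c = 0"
      using independentD[OF C(1) fin order_refl] by blast
    with uB v show False by blast
  qed
  moreover have "span (B \<union> C) = V"
  proof
    show "span (B \<union> C) \<subseteq> V"
      using BV WV C(2) span_superset[of C] by (intro span_minimal V) blast
    show "V \<subseteq> span (B \<union> C)"
    proof
      fix v assume "v \<in> V"
      then obtain c where "v - (\<Sum>b\<in>B. c b *c b) \<in> W"
        using B unfolding quotient_basis_def by blast
      then have "v - (\<Sum>b\<in>B. c b *c b) \<in> span (B \<union> C)"
        using C(2) span_mono[of C "B \<union> C"] by blast
      moreover have "(\<Sum>b\<in>B. c b *c b) \<in> span (B \<union> C)"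
        by (blast intro: span_sum span_scale span_base)
      ultimately show "v \<in> span (B \<union> C)"
        using span_add by fastforce
    qed
  qed
  ultimately have "dim V = card (B \<union> C)"
    using dim_span_eq_card_independent by blast
  then show ?thesis
    using finB fin disj by (simp add: card_Un_disjoint)
qed

lemma quotient_basis_exists:
  assumes V: "subspace V" and W: "subspace W" and WV: "W \<subseteq> V"
    and fin: "finite A" "V \<subseteq> span A"
  obtains B where "quotient_basis V W B"
proof -
  obtain C where C: "C \<subseteq> W" "independent C" "W \<subseteq> span C"
    using maximal_independent_subset by blast
  obtain D where D: "C \<subseteq> D" "D \<subseteq> V" "independent D" "V \<subseteq> span D"
    using maximal_independent_subset_extend[of C V] C WV by blast
  have finD: "finite D"
    using independent_span_bound[OF fin(1) D(3)] D(2) fin(2) by blast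
  have spanC: "span C = W"
    using C span_minimal[OF C(1) W] by blast
  let ?B = "D - C"
  have finB: "finite ?B" and finC: "finite C"
    using finD D(1) finite_subset by auto
  have "\<exists>!c. (\<forall>b. b \<notin> ?B \<longrightarrow> c b = 0) \<and> v - (\<Sum>b\<in>?B. c b *c b) \<in> W" if "v \<in> V" for v
  proof (rule ex_ex1I)
    have "v \<in> span D"
      using that D(4) by blast
    then obtain u where u: "v = (\<Sum>d\<in>D. u d *c d)"
      using span_finite[OF finD] by auto
    have "v = (\<Sum>d\<in>?B. u d *c d) + (\<Sum>d\<in>C. u d *c d)"
      unfolding u by (rule sum.subset_diff[OF D(1) finD])
    then have "v - (\<Sum>d\<in>?B. u d *c d) = (\<Sum>d\<in>C. u d *c d)"
      by simp
    also have "\<dots> \<in> W"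
      unfolding spanC[symmetric] by (blast intro: span_sum span_scale span_base)
    finally have "v - (\<Sum>d\<in>?B. u d *c d) \<in> W" .
    moreover have "(\<Sum>d\<in>?B. (if d \<in> ?B then u d else 0) *c d) = (\<Sum>d\<in>?B. u d *c d)"
      by (rule sum.cong) auto
    ultimately show "\<exists>c. (\<forall>b. b \<notin> ?B \<longrightarrow> c b = 0) \<and> v - (\<Sum>b\<in>?B. c b *c b) \<in> W"
      by (intro exI[of _ "\<lambda>d. if d \<in> ?B then u d else 0"]) (simp del: Diff_iff)
  next
    fix c c'
    assume c: "(\<forall>b. b \<notin> ?B \<longrightarrow> c b = 0) \<and> v - (\<Sum>b\<in>?B. c b *c b) \<in> W"
      and c': "(\<forall>b. b \<notin> ?B \<longrightarrow> c' b = 0) \<and> v - (\<Sum>b\<in>?B. c' b *c b) \<in> W"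
    have "(v - (\<Sum>b\<in>?B. c' b *c b)) - (v - (\<Sum>b\<in>?B. c b *c b)) \<in> W"
      using c c' subspace_diff[OF W] by blast
    then have "(\<Sum>b\<in>?B. (c b - c' b) *c b) \<in> span C"
      unfolding spanC by (simp add: scale_left_diff_distrib sum_subtractf)
    then obtain u where u: "(\<Sum>b\<in>?B. (c b - c' b) *c b) = (\<Sum>d\<in>C. u d *c d)"
      using span_finite[OF finC] by auto
    let ?u = "\<lambda>d. if d \<in> C then - u d else c d - c' d"
    have "(\<Sum>d\<in>D. ?u d *c d) = (\<Sum>d\<in>?B. ?u d *c d) + (\<Sum>d\<in>C. ?u d *c d)"
      by (rule sum.subset_diff[OF D(1) finD])
    also have "(\<Sum>d\<in>?B. ?u d *c d) = (\<Sum>b\<in>?B. (c b - c' b) *c b)"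
      by (rule sum.cong) auto
    also have "(\<Sum>d\<in>C. ?u d *c d) = - (\<Sum>d\<in>C. u d *c d)"
      by (simp add: sum_negf)
    finally have "(\<Sum>d\<in>D. ?u d *c d) = 0"
      using u by simp
    then have "?u d = 0" if "d \<in> D" for d
      using independentD[OF D(3) finD order_refl, of ?u] that by blast
    then have "c d = c' d" if "d \<in> ?B" for d
      using that by (metis DiffE eq_iff_diff_eq_0)
    then show "c = c'"
      using c c' by (metis ext)
  qed
  then have "quotient_basis V W ?B"
    unfolding quotient_basis_def using finB D(2) by blast
  then show ?thesis
    using that by blast
qed

lemma quotient_dim_add:
  assumes V: "subspace V" and W: "subspace W" and WV: "W \<subseteq> V"
    and fin: "finite A" "V \<subseteq> span A"
  shows "quotient_dim V W + dim W = dim V"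
proof -
  obtain C where C: "C \<subseteq> W" "independent C" "W \<subseteq> span C"
    using maximal_independent_subset by blast
  have finC: "finite C"
    using independent_span_bound[OF fin(1) C(2)] C(1) WV fin(2) by blast
  have spanC: "span C = W"
    using C span_minimal[OF C(1) W] by blast
  note * = quotient_basis_card[OF V W WV finC C(2) spanC]
  obtain B where B: "quotient_basis V W B"
    using quotient_basis_exists[OF assms] .
  have "quotient_dim V W = card B"
    unfolding quotient_dim_def
  proof (rule the_equality)
    show "\<exists>B'. quotient_basis V W B' \<and> card B' = card B"
      using B by blast
    show "n = card B" if "\<exists>B'. quotient_basis V W B' \<and> card B' = n" for n
      using that *[OF B] * by fastforce
  qed
  moreover have "dim W = card C"
    using dim_span_eq_card_independent[OF C(2)] spanC by simp
  ultimately show ?thesis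
    using *[OF B] by simp
qed

end


section \<open>The graded ring $S = \mathbb{C}[x,y,z]$\<close>

text \<open>A monomial is its exponent vector; the variables $x, y, z$ are indexed by the elements
  $0, 1, 2$ of the three-element type \<open>3\<close>.\<close>

type_synonym poly3 = "(3 \<Rightarrow>\<^sub>0 nat) \<Rightarrow>\<^sub>0 complex"

definition var3 :: "3 \<Rightarrow> poly3" where
  "var3 i = Poly_Mapping.single (Poly_Mapping.single i 1) 1"

definition cscale :: "complex \<Rightarrow> poly3 \<Rightarrow> poly3" where
  "cscale c p = Poly_Mapping.single 0 c * p"

definition mdeg :: "(3 \<Rightarrow>\<^sub>0 nat) \<Rightarrow> nat" where
  "mdeg m = (\<Sum>i\<in>UNIV. Poly_Mapping.lookup m i)"

text \<open>The component \<open>S\<^sub>k\<close>, for \<^emph>\<open>integral\<close> \<open>k\<close>; it contains \<open>0\<close>, and is \<open>{0}\<close> if \<open>k < 0\<close>.\<close>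

definition S_comp :: "int \<Rightarrow> poly3 set" where
  "S_comp k = {p. \<forall>m\<in>Poly_Mapping.keys p. int (mdeg m) = k}"

text \<open>In the summands where the truncated subtraction of exponents matters, the coefficient
  is zero.\<close>

definition partial :: "3 \<Rightarrow> poly3 \<Rightarrow> poly3" where
  "partial i p = (\<Sum>m\<in>Poly_Mapping.keys p.
     Poly_Mapping.single (m - Poly_Mapping.single i 1)
       (of_nat (Poly_Mapping.lookup m i) * Poly_Mapping.lookup p m))"

lemma lookup_partial:
  "Poly_Mapping.lookup (partial i p) m =
     of_nat (Poly_Mapping.lookup m i + 1) * Poly_Mapping.lookup p (m + Poly_Mapping.single i 1)"
proof -
  let ?e = "Poly_Mapping.single i (1::nat)"
  have eq: "n = m + ?e" if "n - ?e = m" "Poly_Mapping.lookup n i \<noteq> 0" for n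
    using that by (intro poly_mapping_eqI) (auto simp: lookup_add lookup_minus lookup_single when_def)
  have "Poly_Mapping.lookup (partial i p) m = (\<Sum>n\<in>Poly_Mapping.keys p.
      if n = m + ?e then of_nat (Poly_Mapping.lookup n i) * Poly_Mapping.lookup p n else 0)"
    unfolding partial_def lookup_sum
    by (rule sum.cong[OF refl]) (use eq in \<open>auto simp: lookup_single when_def\<close>)
  also have "\<dots> = of_nat (Poly_Mapping.lookup m i + 1) * Poly_Mapping.lookup p (m + ?e)"
    by (simp add: lookup_add lookup_single in_keys_iff)
  finally show ?thesis .
qed

global_interpretation cspace: vector_space_quotient cscale
proof
  fix a b :: complex and p q :: poly3
  show "cscale a (p + q) = cscale a p + cscale a q"
    by (simp add: cscale_def distrib_left)
  show "cscale (a + b) p = cscale a p + cscale b p"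
    by (simp add: cscale_def distrib_right single_add)
  show "cscale a (cscale b p) = cscale (a * b) p"
    by (simp add: cscale_def mult_single flip: mult.assoc)
  show "cscale 1 p = p"
    by (simp add: cscale_def)
qed

lemma module_poly3: "module ((*) :: poly3 \<Rightarrow> poly3 \<Rightarrow> poly3)"
proof
  fix a b p q :: poly3
  show "a * (p + q) = a * p + a * q"
    by (rule distrib_left)
  show "(a + b) * p = a * p + b * p"
    by (rule distrib_right)
  show "a * (b * p) = (a * b) * p"
    by (rule mult.assoc[symmetric])
  show "1 * p = p"
    by (rule mult_1_left)
qed

global_interpretation S3: module "(*s) :: poly3 \<Rightarrow> poly3 ^ 3 \<Rightarrow> poly3 ^ 3"
proof
  fix a b :: poly3 and r s :: "poly3 ^ 3"
  show "a *s (r + s) = a *s r + a *s s"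
    by (simp add: vector_scalar_mult_def vec_eq_iff distrib_left)
  show "(a + b) *s r = a *s r + b *s r"
    by (simp add: vector_scalar_mult_def vec_eq_iff distrib_right)
  show "a *s (b *s r) = (a * b) *s r"
    by (simp add: vector_scalar_mult_def vec_eq_iff mult.assoc)
  show "1 *s r = r"
    by (simp add: vector_scalar_mult_def vec_eq_iff)
qed

text \<open>The ideal generated by a set, i.e. the submodule of \<open>S\<close> spanned by it. The interpretation
  of \<open>module\<close> for multiplication is deliberately not global: it would turn associativity into a
  simplification rule.\<close>

definition ideal_gen :: "poly3 set \<Rightarrow> poly3 set" where
  "ideal_gen = module.span (*)"


section \<open>Saturation and the Jacobian module\<close>

definition ideal_mult :: "poly3 set \<Rightarrow> poly3 set \<Rightarrow> poly3 set" where
  "ideal_mult I J = ideal_gen {a * b |a b. a \<in> I \<and> b \<in> J}"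

primrec ideal_power :: "poly3 set \<Rightarrow> nat \<Rightarrow> poly3 set" where
  "ideal_power I 0 = UNIV"
| "ideal_power I (Suc n) = ideal_mult I (ideal_power I n)"

definition max_ideal :: "poly3 set" where
  "max_ideal = ideal_gen (range var3)"

definition saturation :: "poly3 set \<Rightarrow> poly3 set" where
  "saturation I = {p. \<exists>n. \<forall>q\<in>ideal_power max_ideal n. q * p \<in> I}"

definition jacobian_ideal :: "poly3 \<Rightarrow> poly3 set" where
  "jacobian_ideal f = ideal_gen (range (\<lambda>i. partial i f))"

text \<open>\<open>N(f)\<close> carries the grading induced from \<open>S\<close>, so its degree \<open>k\<close> piece is the quotient of
  the degree \<open>k\<close> pieces of the saturation and of the Jacobian ideal.\<close>

definition n_jac :: "poly3 \<Rightarrow> int \<Rightarrow> nat" where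
  "n_jac f k = cspace.quotient_dim
     (saturation (jacobian_ideal f) \<inter> S_comp k) (jacobian_ideal f \<inter> S_comp k)"

text \<open>Meaningful only if \<open>N(f) \<noteq> 0\<close>.\<close>

definition sigma_jac :: "poly3 \<Rightarrow> int" where
  "sigma_jac f = (LEAST k. n_jac f k \<noteq> 0)"


section \<open>Plane curves and Jacobian syzygies\<close>

text \<open>\<open>squarefree f\<close> implies \<open>f \<noteq> 0\<close>.\<close>

definition reduced_plane_curve :: "nat \<Rightarrow> poly3 \<Rightarrow> bool" where
  "reduced_plane_curve d f \<longleftrightarrow> d \<ge> 1 \<and> f \<in> S_comp (int d) \<and> squarefree f"

definition Syz :: "poly3 \<Rightarrow> (poly3 ^ 3) set" where
  "Syz f = {r. (\<Sum>i\<in>UNIV. r $ i * partial i f) = 0}"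

definition S3_comp :: "int \<Rightarrow> (poly3 ^ 3) set" where
  "S3_comp k = {r. \<forall>i. r $ i \<in> S_comp k}"

definition minimally_generates :: "(poly3 ^ 3) list \<Rightarrow> (poly3 ^ 3) set \<Rightarrow> bool" where
  "minimally_generates rs M \<longleftrightarrow>
     S3.span (set rs) = M \<and>
     (\<forall>i<length rs. S3.span {rs ! j |j. j < length rs \<and> j \<noteq> i} \<noteq> M)"

text \<open>The exponents \<open>ds\<close> of an \<open>m\<close>-syzygy curve are a multiset, represented by its weakly
  increasing list. Generators are kept in a list, so that irredundancy is by position.\<close>

definition syzygy_curve :: "nat \<Rightarrow> nat list \<Rightarrow> poly3 \<Rightarrow> bool" where
  "syzygy_curve m ds f \<longleftrightarrow>
     length ds = m \<and> sorted ds \<and> (\<forall>\<delta>\<in>set ds. 1 \<le> \<delta>) \<and>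
     (\<exists>rs. length rs = m \<and> (\<forall>i<m. rs ! i \<in> S3_comp (int (ds ! i))) \<and>
        minimally_generates rs (Syz f))"

definition plus_one_generated :: "nat \<Rightarrow> poly3 \<Rightarrow> bool" where
  "plus_one_generated d f \<longleftrightarrow>
     (\<exists>d1 d2 d3. syzygy_curve 3 [d1, d2, d3] f \<and> d1 + d2 = d \<and> d2 \<le> d3)"

end

theory Submission
  imports
    Defs
    "HOL-Computational_Algebra.Polynomial_Factorial"
    "HOL-Computational_Algebra.Field_as_Ring"
    "HOL-Analysis.Cartesian_Space"
begin

text \<open>Let \<open>F\<close> be the gradient of \<open>f\<close>, a coprime triple because \<open>f\<close> is squarefree, and let \<open>R\<close> be the matrix of
  the three syzygies. The cross products of the columns of \<open>R\<close> are \<open>h\<^sub>i F\<close>, and \<open>h = (h\<^sub>1, h\<^sub>2, h\<^sub>3)\<close> spans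
  the relations between the syzygies. Writing the Koszul syzygies as \<open>R A\<close>, the determinant \<open>u\<close> of \<open>A\<close> has
  degree \<open>\<sigma>\<close>, \<open>A F = u h\<close>, and the four minors of the matrix with rows \<open>(A\<^sub>i, -h\<^sub>i)\<close> are \<open>F\<close> and \<open>u\<close>. Its
  rows are a basis of the syzygies of \<open>F\<close> and \<open>u\<close>, so the sum \<open>Q\<close> of the Jacobian ideal
  \<open>J\<close> and \<open>(u)\<close> has a Hilbert-Burch resolution and is saturated. Comparing dimensions, \<open>Q\<close> and \<open>J\<close> agree in large degrees, so \<open>Q\<close> is the saturation of \<open>J\<close>, and
  the two resolutions give \<open>n(f)\<^sub>k\<close> as the Hilbert function of a complete intersection with generators in
  degrees \<open>k\<^sub>i - \<sigma>\<close>, evaluated at \<open>k - \<sigma>\<close>.\<close>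

text \<open>The origin of \<open>A\<close> and \<open>u\<close>: the Koszul complex of
  \<open>F\<close> maps to the resolution of the Jacobian ideal formed by \<open>h\<close>,
  \<open>R\<close> and \<open>F\<close>. The map on the Koszul syzygies is \<open>A\<close>, the map
  at the far end is multiplication by \<open>u\<close>, whence \<open>A F = u h\<close>. The class
  of \<open>u\<close> generates N(f), and its annihilator is the ideal of the \<open>h i\<close>; so
  N(f) starts in the degree of \<open>u\<close>, and \<open>h i\<close> has degree
  \<open>k_i - \<sigma>\<close>. The obstacle is that \<open>F\<close> is only known to be coprime,
  and that \<open>h\<close> is not known beforehand to be a regular sequence. Hence nothing rests on
  depth or dimension theory: identities are checked after multiplication by every
  \<open>F j\<close>, common factors are removed by unique factorisation, and exactness is read off
  explicit matrices. Minimality of the generators makes the constant terms of the \<open>h i\<close>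
  vanish, which yields both that \<open>u\<close> is nonzero and that
  \<open>d1 + d2 \<ge> d\<close>.\<close>

abbreviation lkp :: "('a \<Rightarrow>\<^sub>0 'b::zero) \<Rightarrow> 'a \<Rightarrow> 'b" where "lkp \<equiv> Poly_Mapping.lookup"

section \<open>Evaluation homomorphisms and unique factorisation\<close>

lemma poly_mapping_sum_single: "p = (\<Sum>m\<in>Poly_Mapping.keys p. Poly_Mapping.single m (lkp p m))"
  by (rule poly_mapping_eqI) (auto simp: lookup_sum lookup_single when_def in_keys_iff)

text \<open>Identities additive in a polynomial need checking on one-term polynomials only, and the
  sum step carries no disjointness condition on the supports.\<close>

lemma poly_mapping_add_induct [case_names single add]:
  fixes p :: "'a \<Rightarrow>\<^sub>0 'b::comm_monoid_add"
  assumes single: "\<And>m c. P (Poly_Mapping.single m c)"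
    and add: "\<And>p q. P p \<Longrightarrow> P q \<Longrightarrow> P (p + q)"
  shows "P p"
proof -
  have "P (\<Sum>m\<in>A. Poly_Mapping.single m (lkp p m))" if "finite A" for A
    using that
  proof (induction A rule: finite_induct)
    case empty
    show ?case using single[of undefined 0] by simp
  qed (use single add in simp)
  then show ?thesis
    using poly_mapping_sum_single[of p] by (metis finite_keys)
qed

text \<open>The coefficient map is a parameter since three targets occur: iterated univariate
  polynomials (factorisation), polynomials in an auxiliary variable (total degree) and complex
  numbers (value at the origin).\<close>

definition eval3 :: "(complex \<Rightarrow> 'r::comm_ring_1) \<Rightarrow> (3 \<Rightarrow> 'r) \<Rightarrow> poly3 \<Rightarrow> 'r" where
  "eval3 \<iota> X p = (\<Sum>m\<in>Poly_Mapping.keys p. \<iota> (lkp p m) * (\<Prod>i\<in>UNIV. X i ^ lkp m i))"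

locale coeff_hom =
  fixes \<iota> :: "complex \<Rightarrow> 'r::comm_ring_1"
  assumes hom_add: "\<iota> (a + b) = \<iota> a + \<iota> b"
    and hom_mult: "\<iota> (a * b) = \<iota> a * \<iota> b"
    and hom_1: "\<iota> 1 = 1"
begin

lemma hom_0: "\<iota> 0 = 0"
  using hom_add[of 0 0] by simp

lemma eval3_superset:
  assumes "finite A" "Poly_Mapping.keys p \<subseteq> A"
  shows "eval3 \<iota> X p = (\<Sum>m\<in>A. \<iota> (lkp p m) * (\<Prod>i\<in>UNIV. X i ^ lkp m i))"
  unfolding eval3_def using assms
  by (intro sum.mono_neutral_left) (auto simp: in_keys_iff hom_0)

lemma eval3_add: "eval3 \<iota> X (p + q) = eval3 \<iota> X p + eval3 \<iota> X q"
proof -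
  let ?A = "Poly_Mapping.keys p \<union> Poly_Mapping.keys q"
  have "finite ?A" "Poly_Mapping.keys (p + q) \<subseteq> ?A"
    using Poly_Mapping.keys_add[of p q] by auto
  then show ?thesis
    by (simp add: eval3_superset[of ?A] lookup_add hom_add distrib_right sum.distrib)
qed

lemma eval3_0 [simp]: "eval3 \<iota> X 0 = 0"
  by (simp add: eval3_def)

lemma eval3_single: "eval3 \<iota> X (Poly_Mapping.single m c) = \<iota> c * (\<Prod>i\<in>UNIV. X i ^ lkp m i)"
  by (cases "c = 0") (simp_all add: eval3_def hom_0)

lemma eval3_mult: "eval3 \<iota> X (p * q) = eval3 \<iota> X p * eval3 \<iota> X q"
proof (induction p rule: poly_mapping_add_induct)
  case (single m c)
  show ?case
  proof (induction q rule: poly_mapping_add_induct)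
    case (single n d)
    show ?case
      by (simp add: mult_single eval3_single hom_mult lookup_add power_add prod.distrib mult_ac)
  qed (simp add: distrib_left eval3_add)
qed (simp add: distrib_right eval3_add)

lemma eval3_1 [simp]: "eval3 \<iota> X 1 = 1"
  using eval3_single[of X 0 1] by (simp add: hom_1)

end

type_synonym ipoly3 = "complex poly poly poly"

text \<open>An isomorphism onto a ring with gcds and prime factorisation, from which both are
  carried back. The index \<open>3\<close>, equal to \<open>0\<close> in its type, falls under the
  last branch and is the outermost variable.\<close>

definition to_ipoly :: "poly3 \<Rightarrow> ipoly3" where
  "to_ipoly = eval3 (\<lambda>c. monom (monom (monom c 0) 0) 0)
     (\<lambda>i. if i = 1 then monom (monom (monom 1 1) 0) 0 else if i = 2 then monom (monom 1 1) 0 else monom 1 1)"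

interpretation ipoly: coeff_hom "\<lambda>c::complex. monom (monom (monom c 0) 0) (0::nat)"
  by unfold_locales (simp_all add: mult_monom flip: add_monom)

lemma to_ipoly_add: "to_ipoly (p + q) = to_ipoly p + to_ipoly q"
  by (simp add: to_ipoly_def ipoly.eval3_add)

lemma to_ipoly_mult: "to_ipoly (p * q) = to_ipoly p * to_ipoly q"
  by (simp add: to_ipoly_def ipoly.eval3_mult)

lemma to_ipoly_1: "to_ipoly 1 = 1"
  by (simp add: to_ipoly_def)

lemma prod_3: "prod f (UNIV :: 3 set) = f 1 * f 2 * f 3"
  for f :: "3 \<Rightarrow> 'a::comm_monoid_mult"
  unfolding UNIV_3 by (simp add: ac_simps)

lemma to_ipoly_single:
  "to_ipoly (Poly_Mapping.single m c) = monom (monom (monom c (lkp m 1)) (lkp m 2)) (lkp m 3)"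
  by (simp add: to_ipoly_def ipoly.eval3_single prod_3 monom_power mult_monom)

lemma coeff_to_ipoly: "coeff (coeff (coeff (to_ipoly p) (lkp m 3)) (lkp m 2)) (lkp m 1) = lkp p m"
proof (induction p rule: poly_mapping_add_induct)
  case (single n c)
  have "n = m \<longleftrightarrow> lkp n 1 = lkp m 1 \<and> lkp n 2 = lkp m 2 \<and> lkp n 3 = lkp m 3"
    by (auto simp: poly_mapping_eq_iff fun_eq_iff forall_3)
  then show ?case
    by (auto simp: to_ipoly_single lookup_single when_def)
qed (simp add: to_ipoly_add lookup_add)

lemma to_ipoly_inj: "to_ipoly p = to_ipoly q \<longleftrightarrow> p = q"
  using coeff_to_ipoly by (metis poly_mapping_eqI)

lemma to_ipoly_0 [simp]: "to_ipoly 0 = 0"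
  by (simp add: to_ipoly_def)

lemma to_ipoly_0_iff: "to_ipoly p = 0 \<longleftrightarrow> p = 0"
  using to_ipoly_inj[of p 0] by simp

lemma to_ipoly_surj: "\<exists>p. to_ipoly p = P"
proof -
  let ?R = "range to_ipoly"
  have R0: "0 \<in> ?R"
    by (rule image_eqI[of _ _ 0]) (simp_all add: to_ipoly_def)
  have add: "P + Q \<in> ?R" if "P \<in> ?R" "Q \<in> ?R" for P Q
    using that by (auto simp flip: to_ipoly_add)
  have sum: "(\<Sum>i\<in>A. Q i) \<in> ?R" if "\<And>i. Q i \<in> ?R" for A :: "nat set" and Q
    by (induction A rule: infinite_finite_induct) (auto intro: R0 add that)
  have 1: "monom (monom (monom c i) j) k \<in> ?R" for c i j k
  proof -
    define m where "m = Poly_Mapping.single (1::3) i + Poly_Mapping.single 2 j + Poly_Mapping.single 3 k"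
    have "lkp m 1 = i" "lkp m 2 = j" "lkp m 3 = k"
      by (simp_all add: m_def lookup_add lookup_single)
    then have "monom (monom (monom c i) j) k = to_ipoly (Poly_Mapping.single m c)"
      by (simp add: to_ipoly_single)
    then show ?thesis by blast
  qed
  have monom_sum: "monom (\<Sum>i\<in>A. Q i) k = (\<Sum>i\<in>A. monom (Q i) k)"
    for A :: "nat set" and k and Q :: "nat \<Rightarrow> 'a::comm_monoid_add"
    by (induction A rule: infinite_finite_induct) (simp_all flip: add_monom)
  have 2: "monom (monom a j) k \<in> ?R" for a j k
  proof -
    have "monom (monom a j) k = monom (monom (\<Sum>i\<le>degree a. monom (coeff a i) i) j) k"
      by (simp only: poly_as_sum_of_monoms)
    then show ?thesis
      using sum[of "\<lambda>i. monom (monom (monom (coeff a i) i) j) k" "{..degree a}", OF 1]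
      by (simp only: monom_sum)
  qed
  have 3: "monom a k \<in> ?R" for a k
  proof -
    have "monom a k = monom (\<Sum>i\<le>degree a. monom (coeff a i) i) k"
      by (simp only: poly_as_sum_of_monoms)
    then show ?thesis
      using sum[of "\<lambda>i. monom (monom (coeff a i) i) k" "{..degree a}", OF 2]
      by (simp only: monom_sum)
  qed
  have "P \<in> ?R"
    using sum[of "\<lambda>i. monom (coeff P i) i" "{..degree P}", OF 3]
    by (simp only: poly_as_sum_of_monoms)
  then show ?thesis
    by auto
qed

lemma to_ipoly_dvd: "to_ipoly p dvd to_ipoly q \<longleftrightarrow> p dvd q"
  by (metis dvd_def to_ipoly_inj to_ipoly_mult to_ipoly_surj)

lemma poly3_prime_divisor:
  fixes p :: poly3
  assumes "p \<noteq> 0" "\<not> p dvd 1"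
  obtains q where "q dvd p" "prime_elem q"
proof -
  have "to_ipoly p \<noteq> 0" "\<not> is_unit (to_ipoly p)"
    using assms to_ipoly_dvd[of p 1] by (auto simp: to_ipoly_1 to_ipoly_0_iff)
  then obtain Q where Q: "Q dvd to_ipoly p" "prime Q"
    using prime_divisor_exists by blast
  obtain q where q: "Q = to_ipoly q"
    using to_ipoly_surj by metis
  have "prime_elem q"
    unfolding prime_elem_def
  proof (intro conjI allI impI)
    show "q \<noteq> 0" "\<not> q dvd 1"
      using Q(2) q to_ipoly_dvd[of q 1] by (auto simp: to_ipoly_1)
    show "q dvd a \<or> q dvd b" if "q dvd a * b" for a b
      using that Q(2) q by (metis prime_dvd_multD to_ipoly_dvd to_ipoly_mult)
  qed
  with Q(1) q show ?thesis
    using that to_ipoly_dvd by blast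
qed

text \<open>Up to units, the gcd of the \<open>t * v i\<close> is \<open>t\<close> times the gcd of
  the \<open>v i\<close>, and the latter is a unit.\<close>

lemma poly3_dvd_coprime_family:
  fixes a t :: poly3 and v :: "3 \<Rightarrow> poly3"
  assumes cop: "\<And>p. (\<And>i. p dvd v i) \<Longrightarrow> p dvd 1" and dvd: "\<And>i. a dvd t * v i"
  shows "a dvd t"
proof -
  let ?g = "gcd (to_ipoly (v 1)) (gcd (to_ipoly (v 2)) (to_ipoly (v 3)))"
  obtain p where p: "to_ipoly p = ?g"
    using to_ipoly_surj by metis
  have "to_ipoly p dvd to_ipoly (v 1)" "to_ipoly p dvd to_ipoly (v 2)" "to_ipoly p dvd to_ipoly (v 3)"
    unfolding p by (meson dvd_trans gcd_dvd1 gcd_dvd2)+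
  then have "\<forall>i. p dvd v i"
    by (simp add: forall_3 to_ipoly_dvd)
  then have "p dvd 1"
    using cop by blast
  then have unit: "is_unit ?g"
    using to_ipoly_dvd[of p 1] p by (simp add: to_ipoly_1)
  have "to_ipoly a dvd to_ipoly t * to_ipoly (v i)" for i
    using dvd[of i] by (simp flip: to_ipoly_dvd add: to_ipoly_mult)
  moreover have "A dvd T * gcd X Y" if "A dvd T * X" "A dvd T * Y" for A T X Y :: ipoly3
    using that by (metis dvd_normalize_iff gcd_greatest gcd_mult_left)
  ultimately have "to_ipoly a dvd to_ipoly t * ?g"
    by presburger
  then have "to_ipoly a dvd to_ipoly t"
    using unit by (simp only: dvd_mult_unit_iff)
  then show ?thesis
    by (simp add: to_ipoly_dvd)
qed

section \<open>The grading and partial derivatives\<close>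

definition hpart :: "int \<Rightarrow> poly3 \<Rightarrow> poly3" where
  "hpart k = Poly_Mapping.mapp (\<lambda>m c. c when int (mdeg m) = k)"

lemma lookup_hpart: "lkp (hpart k p) m = (lkp p m when int (mdeg m) = k)"
  by (auto simp: hpart_def lookup_mapp when_def in_keys_iff)

lemma hpart_add: "hpart k (p + q) = hpart k p + hpart k q"
  by (rule poly_mapping_eqI) (simp add: lookup_hpart lookup_add when_add_distrib)

lemma hpart_0 [simp]: "hpart k 0 = 0"
  by (rule poly_mapping_eqI) (simp add: lookup_hpart)

lemma hpart_sum: "hpart k (sum g A) = (\<Sum>i\<in>A. hpart k (g i))"
  by (induction A rule: infinite_finite_induct) (simp_all add: hpart_add)

lemma S_comp_iff: "p \<in> S_comp k \<longleftrightarrow> (\<forall>m. lkp p m \<noteq> 0 \<longrightarrow> int (mdeg m) = k)"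
  by (auto simp: S_comp_def in_keys_iff)

lemma hpart_in_S_comp: "hpart k p \<in> S_comp k"
  by (simp add: S_comp_iff lookup_hpart)

lemma hpart_S_comp: "p \<in> S_comp l \<Longrightarrow> hpart k p = (if k = l then p else 0)"
  by (rule poly_mapping_eqI) (auto simp: S_comp_iff lookup_hpart when_def)

lemma S_comp_0 [simp]: "0 \<in> S_comp k"
  by (simp add: S_comp_iff)

lemma S_comp_add: "p \<in> S_comp k \<Longrightarrow> q \<in> S_comp k \<Longrightarrow> p + q \<in> S_comp k"
  unfolding S_comp_def using Poly_Mapping.keys_add[of p q] by blast

lemma S_comp_minus: "p \<in> S_comp k \<Longrightarrow> - p \<in> S_comp k"
  by (simp add: S_comp_iff)

lemma S_comp_diff: "p \<in> S_comp k \<Longrightarrow> q \<in> S_comp k \<Longrightarrow> p - q \<in> S_comp k"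
  using S_comp_add[of p k "- q"] S_comp_minus by simp

lemma S_comp_sum: "(\<And>i. i \<in> A \<Longrightarrow> g i \<in> S_comp k) \<Longrightarrow> sum g A \<in> S_comp k"
  by (induction A rule: infinite_finite_induct) (auto intro: S_comp_add)

lemma S_comp_single: "int (mdeg m) = k \<Longrightarrow> Poly_Mapping.single m c \<in> S_comp k"
  by (simp add: S_comp_def)

lemma mdeg_add: "mdeg (m + n) = mdeg m + mdeg n"
  by (simp add: mdeg_def lookup_add sum.distrib)

lemma mdeg_single [simp]: "mdeg (Poly_Mapping.single i n) = n"
  by (simp add: mdeg_def lookup_single when_def)

lemma mdeg_0 [simp]: "mdeg 0 = 0"
  by (simp add: mdeg_def)

lemma mdeg_eq_0_iff [simp]: "mdeg m = 0 \<longleftrightarrow> m = 0"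
  by (auto simp: mdeg_def intro: poly_mapping_eqI)

lemma S_comp_mult: "p \<in> S_comp k \<Longrightarrow> q \<in> S_comp l \<Longrightarrow> p * q \<in> S_comp (k + l)"
  unfolding S_comp_def using Poly_Mapping.keys_mult[of p q] by (fastforce simp: mdeg_add)

lemma S_comp_const_mult: "p \<in> S_comp k \<Longrightarrow> Poly_Mapping.single 0 c * p \<in> S_comp k"
  using S_comp_mult[of "Poly_Mapping.single 0 c" 0 p k] S_comp_single[of 0 0 c] by simp

lemma hpart_mult:
  assumes q: "q \<in> S_comp e"
  shows "hpart k (p * q) = hpart (k - e) p * q"
proof (induction p rule: poly_mapping_add_induct)
  case (single m c)
  show ?case
    using hpart_S_comp[OF S_comp_mult[OF S_comp_single[OF refl] q]]
      hpart_S_comp[OF S_comp_single[OF refl]] by auto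
qed (simp add: distrib_right hpart_add)

lemma S_comp_mult_cancel:
  assumes "t * q \<in> S_comp l" "q \<in> S_comp e" "q \<noteq> 0"
  shows "t \<in> S_comp (l - e)"
proof -
  have "hpart (l - e) t * q = t * q"
    using assms hpart_mult[of q e l t] hpart_S_comp[of "t * q" l l] by simp
  then have "hpart (l - e) t = t"
    using assms(3) by simp
  then show ?thesis
    using hpart_in_S_comp by metis
qed

lemma poly3_const:
  assumes "p \<in> S_comp 0"
  shows "p = Poly_Mapping.single 0 (lkp p 0)"
  using assms by (intro poly_mapping_eqI) (auto simp: S_comp_iff lookup_single when_def)

lemma single_0_is_unit: "c \<noteq> (0::complex) \<Longrightarrow> (Poly_Mapping.single 0 c :: poly3) dvd 1"
  by (rule dvdI[of _ _ "Poly_Mapping.single 0 (1 / c)"]) (simp add: mult_single)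

text \<open>The substitution of \<open>var3 i\<close> times a new variable for
  \<open>var3 i\<close>: total degree becomes the degree in the new variable, which is additive on
  products over a domain, also for inhomogeneous factors.\<close>

definition grade3 :: "poly3 \<Rightarrow> poly3 poly" where
  "grade3 = eval3 (\<lambda>c. monom (Poly_Mapping.single 0 c) 0) (\<lambda>i. monom (var3 i) 1)"

interpretation grade3: coeff_hom "\<lambda>c::complex. monom (Poly_Mapping.single (0 :: 3 \<Rightarrow>\<^sub>0 nat) c) 0"
  by unfold_locales (simp_all add: mult_monom mult_single single_add flip: add_monom)

lemma var3_power: "var3 i ^ n = Poly_Mapping.single (Poly_Mapping.single i n) 1"
  by (induction n) (simp_all add: var3_def mult_single flip: single_add)

lemma grade3_single: "grade3 (Poly_Mapping.single m c) = monom (Poly_Mapping.single m c) (mdeg m)"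
proof -
  have "Poly_Mapping.single 1 (lkp m 1) + Poly_Mapping.single 2 (lkp m 2)
      + Poly_Mapping.single 3 (lkp m 3) = m"
    unfolding poly_mapping_eq_iff fun_eq_iff forall_3
    by (simp add: lookup_add lookup_single)
  then show ?thesis
    by (simp add: grade3_def grade3.eval3_single prod_3 mdeg_def sum_3 monom_power mult_monom
        var3_power mult_single add_ac)
qed

lemma coeff_grade3: "coeff (grade3 p) n = hpart (int n) p"
proof (induction p rule: poly_mapping_add_induct)
  case (single m c)
  then show ?case
    using hpart_S_comp[OF S_comp_single[OF refl], of "int n" m c] by (auto simp: grade3_single)
qed (simp add: hpart_add grade3_def grade3.eval3_add)

text \<open>A nonzero derivative has smaller total degree than \<open>p\<close>, so it cannot be a
  multiple of \<open>p\<close>. The prime factor to which this is applied is not known to be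
  homogeneous.\<close>

lemma dvd_partial_imp_0:
  assumes "p dvd partial i p"
  shows "partial i p = 0"
proof (rule ccontr)
  assume nz: "partial i p \<noteq> 0"
  obtain s where s: "partial i p = p * s"
    using assms by blast
  have nz': "grade3 q \<noteq> 0" if "q \<noteq> 0" for q
  proof -
    obtain m where "lkp q m \<noteq> 0"
      using \<open>q \<noteq> 0\<close> by (metis lookup_zero poly_mapping_eqI)
    then have "lkp (coeff (grade3 q) (mdeg m)) m \<noteq> 0"
      by (simp add: coeff_grade3 lookup_hpart)
    then show ?thesis by auto
  qed
  have "grade3 (partial i p) = grade3 p * grade3 s"
    by (simp add: s grade3_def grade3.eval3_mult)
  then have le: "degree (grade3 p) \<le> degree (grade3 (partial i p))" (is "_ \<le> ?n")
    using nz s nz' by (auto simp: degree_mult_eq)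
  have "coeff (grade3 (partial i p)) ?n \<noteq> 0"
    using nz nz' by simp
  then obtain m where "lkp (hpart (int ?n) (partial i p)) m \<noteq> 0"
    by (metis coeff_grade3 lookup_zero poly_mapping_eqI)
  then have m: "mdeg m = ?n" "lkp p (m + Poly_Mapping.single i 1) \<noteq> 0"
    by (auto simp: lookup_hpart lookup_partial)
  then have "lkp (coeff (grade3 p) (?n + 1)) (m + Poly_Mapping.single i 1) \<noteq> 0"
    by (simp add: coeff_grade3 lookup_hpart mdeg_add)
  then have "?n + 1 \<le> degree (grade3 p)"
    by (intro le_degree) auto
  with le show False by simp
qed

section \<open>Derivation rules and Euler's identity\<close>

lemma partial_add: "partial i (p + q) = partial i p + partial i q"
  by (rule poly_mapping_eqI) (simp add: lookup_partial lookup_add algebra_simps)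

lemma partial_single: "partial i (Poly_Mapping.single m c) =
    Poly_Mapping.single (m - Poly_Mapping.single i 1) (of_nat (lkp m i) * c)"
  by (cases "c = 0") (simp_all add: partial_def)

lemma monomial_minus_add:
  assumes "lkp m i \<noteq> (0::nat)"
  shows "m - Poly_Mapping.single i 1 + n = m + n - Poly_Mapping.single i 1"
  using assms by (intro poly_mapping_eqI) (auto simp: lookup_add lookup_minus lookup_single when_def)

text \<open>Truncated subtraction can make the two exponents differ only when
  \<open>lkp m i = 0\<close>, and then both coefficients vanish.\<close>

lemma single_monomial_shift:
  "Poly_Mapping.single (m - Poly_Mapping.single i 1 + n) (of_nat (lkp m i) * (c::complex)) =
   Poly_Mapping.single (m + n - Poly_Mapping.single i 1) (of_nat (lkp m i) * c)"
  using monomial_minus_add[of m i n] by (cases "lkp m i = 0") simp_all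

lemma partial_mult: "partial i (p * q) = partial i p * q + p * partial i q"
proof (induction p rule: poly_mapping_add_induct)
  case (single m c)
  show ?case
  proof (induction q rule: poly_mapping_add_induct)
    case (single n d)
    show ?case
      using single_monomial_shift[of m i n "c * d"] single_monomial_shift[of n i m "c * d"]
      by (simp add: mult_single partial_single lookup_add mult_ac add_ac)
        (simp add: distrib_left single_add)
  qed (simp add: distrib_left partial_add add_ac)
qed (simp add: distrib_right partial_add add_ac)

lemma partial_S_comp: "f \<in> S_comp k \<Longrightarrow> partial i f \<in> S_comp (k - 1)"
  by (force simp: S_comp_iff lookup_partial mdeg_add)

lemma euler_single:
  "(\<Sum>i\<in>UNIV. var3 i * partial i (Poly_Mapping.single m c)) = Poly_Mapping.single m (of_nat (mdeg m) * c)"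
proof -
  have "var3 i * partial i (Poly_Mapping.single m c) = Poly_Mapping.single m (of_nat (lkp m i) * c)" for i
    using single_monomial_shift[of m i "Poly_Mapping.single i 1" c]
    by (simp add: var3_def partial_single mult_single add.commute)
  then show ?thesis
    by (simp add: mdeg_def single_add[symmetric] sum_3 distrib_right)
qed

lemma euler:
  assumes "f \<in> S_comp (int d)"
  shows "(\<Sum>i\<in>UNIV. var3 i * partial i f) = Poly_Mapping.single 0 (of_nat d) * f"
proof -
  let ?E = "\<lambda>p. \<Sum>i\<in>UNIV. var3 i * partial i p"
  have lk: "lkp (?E p) m = of_nat (mdeg m) * lkp p m" for p m
  proof (induction p rule: poly_mapping_add_induct)
    case (single n c)
    then show ?case
      unfolding euler_single by (simp add: lookup_single when_def)
  qed (simp add: partial_add distrib_left sum.distrib lookup_add)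
  have lk2: "lkp (Poly_Mapping.single 0 c * p) m = c * lkp p m" for c and p :: poly3 and m
    by (simp add: Poly_Mapping.map.rep_eq when_def flip: mult_map_scale_conv_mult)
  show ?thesis
    by (rule poly_mapping_eqI) (use assms lk2[of "of_nat d" f] in \<open>auto simp: lk S_comp_iff\<close>)
qed

text \<open>Characteristic zero: a positive exponent survives as a nonzero factor in the
  corresponding derivative.\<close>

lemma partial_all_0_const:
  assumes "\<And>i. partial i p = 0"
  shows "p = Poly_Mapping.single 0 (lkp p 0)"
proof (rule poly3_const, unfold S_comp_iff, intro allI impI)
  fix m assume m: "lkp p m \<noteq> 0"
  have "lkp m i = 0" for i
  proof (rule ccontr)
    assume i: "lkp m i \<noteq> 0"
    have eq: "m - Poly_Mapping.single i 1 + Poly_Mapping.single i 1 = m"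
      unfolding monomial_minus_add[OF i] by simp
    have "complex_of_nat (lkp (m - Poly_Mapping.single i 1) i + 1) \<noteq> 0"
      unfolding of_nat_eq_0_iff by simp
    then have "lkp (partial i p) (m - Poly_Mapping.single i 1) \<noteq> 0"
      using m unfolding lookup_partial eq by (metis mult_eq_0_iff)
    then show False
      using assms by simp
  qed
  then show "int (mdeg m) = 0"
    by (simp add: mdeg_def)
qed

section \<open>Coprimality of the gradient\<close>

lemma dvd_unit_mult_cancel:
  fixes u :: "'a::comm_semiring_1"
  assumes "u dvd 1" "q dvd u * f"
  shows "q dvd f"
proof -
  obtain v where "1 = u * v"
    using assms(1) by blast
  moreover have "(u * f) * v = f * (u * v)"
    by (simp add: mult_ac)
  ultimately show ?thesis
    using dvd_mult2[OF assms(2), of v] by simp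
qed

text \<open>A prime \<open>q\<close> dividing all partials divides \<open>f\<close> by Euler's
  identity, so \<open>f = q * g\<close>, where squarefreeness keeps \<open>q\<close> from dividing
  \<open>g\<close>. The product rule then makes \<open>q\<close> divide its own derivatives, which
  forces \<open>q\<close> to be constant.\<close>

lemma gradient_coprime:
  assumes curve: "reduced_plane_curve d f" and dvd: "\<And>i. p dvd partial i f"
  shows "p dvd 1"
proof (rule ccontr)
  assume nu: "\<not> p dvd 1"
  have f: "f \<in> S_comp (int d)" "squarefree f" "d \<ge> 1"
    using curve by (auto simp: reduced_plane_curve_def)
  have f0: "f \<noteq> 0"
    using f(2) by auto
  have unit: "(Poly_Mapping.single 0 (of_nat d) :: poly3) dvd 1"
    using f(3) by (intro single_0_is_unit) simp
  have dvd_f: "q dvd f" if "\<And>i. q dvd partial i f" for q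
  proof -
    have "q dvd (\<Sum>i\<in>UNIV. var3 i * partial i f)"
      using that by (intro dvd_sum dvd_mult) auto
    then have "q dvd Poly_Mapping.single 0 (of_nat d) * f"
      by (simp add: euler[OF f(1)])
    then show ?thesis
      by (rule dvd_unit_mult_cancel[OF unit])
  qed
  have "p \<noteq> 0"
    using dvd_f[OF dvd] f0 by auto
  then obtain q where q: "q dvd p" "prime_elem q"
    using nu poly3_prime_divisor by blast
  have qd: "q dvd partial i f" for i
    using q(1) dvd dvd_trans by blast
  obtain g where g: "f = q * g"
    using dvd_f[OF qd] by blast
  have "\<not> q dvd g"
  proof
    assume "q dvd g"
    then have "q ^ 2 dvd f"
      by (auto simp: g power2_eq_square)
    then have "q dvd 1"
      using f(2) by (simp add: squarefree_def)
    then show False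
      using q(2) by (simp add: prime_elem_def)
  qed
  moreover have "q dvd partial i q * g" for i
    using qd[of i] by (simp add: g partial_mult dvd_add_left_iff)
  ultimately have "q dvd partial i q" for i
    using prime_elem_dvd_multD[OF q(2)] by blast
  then have "q = Poly_Mapping.single 0 (lkp q 0)"
    by (intro partial_all_0_const dvd_partial_imp_0)
  moreover from this have "lkp q 0 \<noteq> 0"
    using q(2) by (metis prime_elem_def single_zero)
  ultimately have "q dvd 1"
    using single_0_is_unit by metis
  then show False
    using q(2) by (simp add: prime_elem_def)
qed

section \<open>Algebra of three generating syzygies\<close>

lemma vec3_eq_iff: "v = w \<longleftrightarrow> v $ 1 = w $ 1 \<and> v $ 2 = w $ 2 \<and> v $ 3 = w $ 3"
  for v w :: "'a ^ 3"
  by (simp add: vec_eq_iff forall_3)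

lemma cauchy_binet_2:
  fixes a b p q :: "3 \<Rightarrow> 'a::comm_ring_1"
  shows "(a 1 * p 1 + a 2 * p 2 + a 3 * p 3) * (b 1 * q 1 + b 2 * q 2 + b 3 * q 3)
      - (b 1 * p 1 + b 2 * p 2 + b 3 * p 3) * (a 1 * q 1 + a 2 * q 2 + a 3 * q 3)
    = (a 2 * b 3 - b 2 * a 3) * (p 2 * q 3 - q 2 * p 3) + (a 3 * b 1 - b 3 * a 1) * (p 3 * q 1 - q 3 * p 1)
      + (a 1 * b 2 - b 1 * a 2) * (p 1 * q 2 - q 1 * p 2)"
  by (simp add: algebra_simps)

text \<open>Vanishing minors make \<open>w\<close> a multiple of \<open>v\<close> over the fraction
  field; coprimality of \<open>v\<close> shows that the factor has no denominator.\<close>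

lemma coprime_family_proportional:
  fixes v w :: "3 \<Rightarrow> poly3"
  assumes cop: "\<And>p. (\<And>i. p dvd v i) \<Longrightarrow> p dvd 1"
    and minors: "\<And>i j. w i * v j = w j * v i"
  obtains c where "\<And>i. w i = c * v i"
proof -
  obtain j where j: "v j \<noteq> 0"
    using cop[of 0] by auto
  have "v j dvd w j * v i" for i
    using minors[of i j] by (metis dvd_triv_right)
  then have "v j dvd w j"
    using poly3_dvd_coprime_family[of v "v j" "w j"] cop by blast
  then obtain c where c: "w j = v j * c"
    by blast
  have "w i * v j = (c * v i) * v j" for i
    using minors[of i j] c by (simp add: mult_ac)
  then have "w i = c * v i" for i
    using j by simp
  then show ?thesis
    using that by blast
qed

interpretation const_term: coeff_hom "\<lambda>c::complex. c"
  by unfold_locales simp_all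

text \<open>Reading the constant term as the value at the origin makes it multiplicative.\<close>

lemma lookup_0_eq_eval3: "lkp p 0 = eval3 (\<lambda>c. c) (\<lambda>_. 0) p"
proof (induction p rule: poly_mapping_add_induct)
  case (single m c)
  have "(\<Prod>i\<in>UNIV. (0::complex) ^ lkp m i) = (if m = 0 then 1 else 0)"
    unfolding poly_mapping_eq_iff fun_eq_iff forall_3 by (auto simp: prod_3 power_0_left)
  then show ?case
    by (simp add: const_term.eval3_single lookup_single when_def)
qed (simp add: lookup_add const_term.eval3_add)

lemma lookup_0_mult: "lkp (p * q) 0 = lkp p 0 * lkp (q :: poly3) 0"
  by (simp add: lookup_0_eq_eval3 const_term.eval3_mult)

lemma S_comp_0_nonunit:
  assumes "p \<in> S_comp k" "\<not> p dvd 1"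
  shows "lkp p 0 = 0"
proof (rule ccontr)
  assume nz: "lkp p 0 \<noteq> 0"
  then have "k = 0"
    using assms(1) by (auto simp: S_comp_iff)
  then have "p = Poly_Mapping.single 0 (lkp p 0)"
    using assms(1) poly3_const by blast
  then have "p dvd 1"
    using single_0_is_unit[OF nz] by simp
  with assms(2) show False by simp
qed

text \<open>For the curve \<open>D\<close> is \<open>d - 1\<close>; degrees are integers so that
  differences such as \<open>D - \<delta> i\<close> may be negative. \<open>r_minimal\<close>
  rephrases irredundancy: a relation with a unit coefficient would express one generator through the
  others.\<close>

locale three_syzygies =
  fixes F :: "3 \<Rightarrow> poly3" and r :: "3 \<Rightarrow> poly3 ^ 3" and D :: int and \<delta> :: "3 \<Rightarrow> int"
  assumes F_deg: "F i \<in> S_comp D"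
    and F_coprime: "(\<And>i. p dvd F i) \<Longrightarrow> p dvd 1"
    and r_deg: "r i \<in> S3_comp (\<delta> i)"
    and r_generate: "(\<Sum>i\<in>UNIV. w $ i * F i) = 0 \<longleftrightarrow> (\<exists>c. w = (\<Sum>i\<in>UNIV. c i *s r i))"
    and r_minimal: "(\<Sum>i\<in>UNIV. c i *s r i) = 0 \<Longrightarrow> \<not> c j dvd 1"
begin

lemma F_nonzero: obtains j where "F j \<noteq> 0"
  using F_coprime[of 0] by auto

text \<open>It is not known which entry of \<open>F\<close> is nonzero, so identities are proved
  after multiplication by each of the three; there the products \<open>h i * F j\<close> can be
  replaced by minors of the syzygies.\<close>

lemma F_cancel: "(\<And>j. F j * p = F j * q) \<Longrightarrow> p = q"
  using F_nonzero by (metis mult_left_cancel)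

lemma r_syz: "r i $ 1 * F 1 + r i $ 2 * F 2 + r i $ 3 * F 3 = 0"
proof -
  have "r i = (\<Sum>j\<in>UNIV. (if j = i then 1 else 0) *s r j)"
    by (simp add: vec_eq_iff if_distrib[of "\<lambda>x. x * _"] cong: if_cong)
  then have "\<exists>c. r i = (\<Sum>j\<in>UNIV. c j *s r j)"
    by (intro exI[of _ "\<lambda>j. if j = i then 1 else 0"])
  then have "(\<Sum>l\<in>UNIV. r i $ l * F l) = 0"
    using r_generate by blast
  then show ?thesis
    by (simp add: sum_3)
qed

lemma homogeneous_coefficients:
  assumes w: "(\<Sum>i\<in>UNIV. w $ i * F i) = 0" "w \<in> S3_comp k"
  obtains c where "w = (\<Sum>i\<in>UNIV. c i *s r i)" "\<And>i. c i \<in> S_comp (k - \<delta> i)"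
proof -
  obtain c where c: "w = (\<Sum>i\<in>UNIV. c i *s r i)"
    using w(1) r_generate by blast
  have "w $ l = (\<Sum>i\<in>UNIV. hpart (k - \<delta> i) (c i) * r i $ l)" for l
  proof -
    have "w $ l = hpart k (w $ l)"
      using w(2) hpart_S_comp[of "w $ l" k k] by (simp add: S3_comp_def)
    also have "\<dots> = (\<Sum>i\<in>UNIV. hpart k (c i * r i $ l))"
      by (subst c) (simp add: hpart_sum)
    also have "\<dots> = (\<Sum>i\<in>UNIV. hpart (k - \<delta> i) (c i) * r i $ l)"
      using r_deg by (intro sum.cong refl hpart_mult) (simp add: S3_comp_def)
    finally show ?thesis .
  qed
  then have "w = (\<Sum>i\<in>UNIV. hpart (k - \<delta> i) (c i) *s r i)"
    by (simp add: vec_eq_iff)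
  then show ?thesis
    by (rule that[of "\<lambda>i. hpart (k - \<delta> i) (c i)"]) (rule hpart_in_S_comp)
qed

text \<open>Both syzygies are orthogonal to \<open>F\<close>, so their cross product is parallel to
  it, and coprimality of \<open>F\<close> makes the factor a polynomial.\<close>

lemma cross_proportional:
  fixes a b :: "poly3 ^ 3"
  assumes "a $ 1 * F 1 + a $ 2 * F 2 + a $ 3 * F 3 = 0" "b $ 1 * F 1 + b $ 2 * F 2 + b $ 3 * F 3 = 0"
    and deg: "a \<in> S3_comp k" "b \<in> S3_comp l"
  obtains c where "a $ 2 * b $ 3 - a $ 3 * b $ 2 = c * F 1" "a $ 3 * b $ 1 - a $ 1 * b $ 3 = c * F 2"
    "a $ 1 * b $ 2 - a $ 2 * b $ 1 = c * F 3" "c \<in> S_comp (k + l - D)"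
proof -
  define w where "w = (vector [a $ 2 * b $ 3 - a $ 3 * b $ 2, a $ 3 * b $ 1 - a $ 1 * b $ 3,
    a $ 1 * b $ 2 - a $ 2 * b $ 1] :: poly3 ^ 3)"
  have "w $ i * F j = w $ j * F i" for i j
  proof -
    have "\<forall>i j. w $ i * F j = w $ j * F i"
      unfolding forall_3 w_def vector_3 using assms(1,2) by (intro conjI refl; algebra)
    then show ?thesis by blast
  qed
  then obtain c where c: "\<And>i. w $ i = c * F i"
    using coprime_family_proportional[of F "\<lambda>i. w $ i"] F_coprime by blast
  obtain j where j: "F j \<noteq> 0"
    by (rule F_nonzero)
  have "\<forall>i. w $ i \<in> S_comp (k + l)"
    using deg unfolding forall_3 w_def vector_3 S3_comp_def
    by (auto intro!: S_comp_diff S_comp_mult)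
  then have "c * F j \<in> S_comp (k + l)"
    using c[of j] by metis
  then have "c \<in> S_comp (k + l - D)"
    using F_deg j by (rule S_comp_mult_cancel)
  then show ?thesis
    using that[of c] c[of 1] c[of 2] c[of 3] by (simp add: w_def)
qed

end

text \<open>The equations \<open>A_koszul\<close> say that \<open>R A\<close> is the skew-symmetric matrix of \<open>F\<close>, where \<open>R\<close> has the
  columns \<open>r i\<close> and \<open>A\<close> has the rows \<open>A i\<close>; its columns are the Koszul syzygies.\<close>

locale three_syzygies_minors = three_syzygies +
  fixes h :: "3 \<Rightarrow> poly3" and A :: "3 \<Rightarrow> poly3 ^ 3"
  assumes h1: "r 2 $ 2 * r 3 $ 3 - r 2 $ 3 * r 3 $ 2 = h 1 * F 1" "r 2 $ 3 * r 3 $ 1 - r 2 $ 1 * r 3 $ 3 = h 1 * F 2"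
    "r 2 $ 1 * r 3 $ 2 - r 2 $ 2 * r 3 $ 1 = h 1 * F 3"
    and h2: "r 3 $ 2 * r 1 $ 3 - r 3 $ 3 * r 1 $ 2 = h 2 * F 1" "r 3 $ 3 * r 1 $ 1 - r 3 $ 1 * r 1 $ 3 = h 2 * F 2"
    "r 3 $ 1 * r 1 $ 2 - r 3 $ 2 * r 1 $ 1 = h 2 * F 3"
    and h3: "r 1 $ 2 * r 2 $ 3 - r 1 $ 3 * r 2 $ 2 = h 3 * F 1" "r 1 $ 3 * r 2 $ 1 - r 1 $ 1 * r 2 $ 3 = h 3 * F 2"
    "r 1 $ 1 * r 2 $ 2 - r 1 $ 2 * r 2 $ 1 = h 3 * F 3"
    and h_deg: "h i \<in> S_comp ((\<Sum>j\<in>UNIV. \<delta> j) - \<delta> i - D)"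
    and A_koszul: "(\<Sum>i\<in>UNIV. A i $ 1 *s r i) = vector [0, - F 3, F 2]"
    "(\<Sum>i\<in>UNIV. A i $ 2 *s r i) = vector [F 3, 0, - F 1]"
    "(\<Sum>i\<in>UNIV. A i $ 3 *s r i) = vector [- F 2, F 1, 0]"
    and A_deg: "A i \<in> S3_comp (D - \<delta> i)"

lemma (in three_syzygies) ex_minors:
  obtains h A where "three_syzygies_minors F r D \<delta> h A"
proof -
  obtain c1 where c1: "r 2 $ 2 * r 3 $ 3 - r 2 $ 3 * r 3 $ 2 = c1 * F 1" "r 2 $ 3 * r 3 $ 1 - r 2 $ 1 * r 3 $ 3 = c1 * F 2"
    "r 2 $ 1 * r 3 $ 2 - r 2 $ 2 * r 3 $ 1 = c1 * F 3" "c1 \<in> S_comp (\<delta> 2 + \<delta> 3 - D)"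
    using cross_proportional[OF r_syz r_syz r_deg r_deg] by metis
  obtain c2 where c2: "r 3 $ 2 * r 1 $ 3 - r 3 $ 3 * r 1 $ 2 = c2 * F 1" "r 3 $ 3 * r 1 $ 1 - r 3 $ 1 * r 1 $ 3 = c2 * F 2"
    "r 3 $ 1 * r 1 $ 2 - r 3 $ 2 * r 1 $ 1 = c2 * F 3" "c2 \<in> S_comp (\<delta> 3 + \<delta> 1 - D)"
    using cross_proportional[OF r_syz r_syz r_deg r_deg] by metis
  obtain c3 where c3: "r 1 $ 2 * r 2 $ 3 - r 1 $ 3 * r 2 $ 2 = c3 * F 1" "r 1 $ 3 * r 2 $ 1 - r 1 $ 1 * r 2 $ 3 = c3 * F 2"
    "r 1 $ 1 * r 2 $ 2 - r 1 $ 2 * r 2 $ 1 = c3 * F 3" "c3 \<in> S_comp (\<delta> 1 + \<delta> 2 - D)"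
    using cross_proportional[OF r_syz r_syz r_deg r_deg] by metis
  define h where "h = (\<lambda>i::3. if i = 1 then c1 else if i = 2 then c2 else c3)"
  have h: "h 1 = c1" "h 2 = c2" "h 3 = c3"
    by (simp_all add: h_def)
  have h_deg: "\<forall>i. h i \<in> S_comp ((\<Sum>j\<in>UNIV. \<delta> j) - \<delta> i - D)"
    unfolding forall_3 h sum_3 using c1(4) c2(4) c3(4) by (simp add: algebra_simps)
  \<comment> \<open>The Koszul syzygies have degree \<open>D\<close>; homogeneous coefficients for
    them give \<open>A\<close> its grading.\<close>
  have kos: "\<exists>c. w = (\<Sum>i\<in>UNIV. c i *s r i) \<and> (\<forall>i. c i \<in> S_comp (D - \<delta> i))"
    if "w \<in> S3_comp D" "w $ 1 * F 1 + w $ 2 * F 2 + w $ 3 * F 3 = 0" for w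
    using homogeneous_coefficients[of w D] that unfolding sum_3[of "\<lambda>i. w $ i * F i"] by blast
  have "\<exists>c. vector [0, - F 3, F 2] = (\<Sum>i\<in>UNIV. c i *s r i) \<and> (\<forall>i. c i \<in> S_comp (D - \<delta> i))"
    by (rule kos) (simp_all add: S3_comp_def forall_3 F_deg S_comp_minus mult.commute)
  then obtain a1 where a1: "vector [0, - F 3, F 2] = (\<Sum>i\<in>UNIV. a1 i *s r i)" "\<And>i. a1 i \<in> S_comp (D - \<delta> i)"
    by blast
  have "\<exists>c. vector [F 3, 0, - F 1] = (\<Sum>i\<in>UNIV. c i *s r i) \<and> (\<forall>i. c i \<in> S_comp (D - \<delta> i))"
    by (rule kos) (simp_all add: S3_comp_def forall_3 F_deg S_comp_minus mult.commute)
  then obtain a2 where a2: "vector [F 3, 0, - F 1] = (\<Sum>i\<in>UNIV. a2 i *s r i)" "\<And>i. a2 i \<in> S_comp (D - \<delta> i)"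
    by blast
  have "\<exists>c. vector [- F 2, F 1, 0] = (\<Sum>i\<in>UNIV. c i *s r i) \<and> (\<forall>i. c i \<in> S_comp (D - \<delta> i))"
    by (rule kos) (simp_all add: S3_comp_def forall_3 F_deg S_comp_minus mult.commute)
  then obtain a3 where a3: "vector [- F 2, F 1, 0] = (\<Sum>i\<in>UNIV. a3 i *s r i)" "\<And>i. a3 i \<in> S_comp (D - \<delta> i)"
    by blast
  define A where "A = (\<lambda>i. vector [a1 i, a2 i, a3 i] :: poly3 ^ 3)"
  have "three_syzygies_minors F r D \<delta> h A"
  proof
    show "h i \<in> S_comp ((\<Sum>j\<in>UNIV. \<delta> j) - \<delta> i - D)" for i
      using h_deg by blast
    show "A i \<in> S3_comp (D - \<delta> i)" for i
      using a1(2) a2(2) a3(2) by (simp add: A_def S3_comp_def forall_3)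
  qed (simp_all add: h c1 c2 c3 A_def a1(1) a2(1) a3(1))
  then show ?thesis
    using that by blast
qed

context three_syzygies_minors
begin

lemma koszul_entries:
  "A 1 $ 1 * r 1 $ 1 + A 2 $ 1 * r 2 $ 1 + A 3 $ 1 * r 3 $ 1 = 0"
  "A 1 $ 1 * r 1 $ 2 + A 2 $ 1 * r 2 $ 2 + A 3 $ 1 * r 3 $ 2 = - F 3"
  "A 1 $ 1 * r 1 $ 3 + A 2 $ 1 * r 2 $ 3 + A 3 $ 1 * r 3 $ 3 = F 2"
  "A 1 $ 2 * r 1 $ 1 + A 2 $ 2 * r 2 $ 1 + A 3 $ 2 * r 3 $ 1 = F 3"
  "A 1 $ 2 * r 1 $ 2 + A 2 $ 2 * r 2 $ 2 + A 3 $ 2 * r 3 $ 2 = 0"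
  "A 1 $ 2 * r 1 $ 3 + A 2 $ 2 * r 2 $ 3 + A 3 $ 2 * r 3 $ 3 = - F 1"
  "A 1 $ 3 * r 1 $ 1 + A 2 $ 3 * r 2 $ 1 + A 3 $ 3 * r 3 $ 1 = - F 2"
  "A 1 $ 3 * r 1 $ 2 + A 2 $ 3 * r 2 $ 2 + A 3 $ 3 * r 3 $ 2 = F 1"
  "A 1 $ 3 * r 1 $ 3 + A 2 $ 3 * r 2 $ 3 + A 3 $ 3 * r 3 $ 3 = 0"
  using A_koszul[unfolded vec3_eq_iff] by (simp_all add: sum_3)

text \<open>Compare the second exterior powers of the two sides of \<open>R A = [F]\<close>, where \<open>[F]\<close> is the skew-symmetric
  matrix of \<open>F\<close>: the minors of \<open>[F]\<close> are products of entries of \<open>F\<close>, those of \<open>R\<close> are \<open>h i * F j\<close>.\<close>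

lemma F_eq_minors:
  "F 1 = h 1 * (A 2 $ 2 * A 3 $ 3 - A 2 $ 3 * A 3 $ 2) + h 2 * (A 3 $ 2 * A 1 $ 3 - A 3 $ 3 * A 1 $ 2)
    + h 3 * (A 1 $ 2 * A 2 $ 3 - A 1 $ 3 * A 2 $ 2)"
  "F 2 = h 1 * (A 2 $ 3 * A 3 $ 1 - A 2 $ 1 * A 3 $ 3) + h 2 * (A 3 $ 3 * A 1 $ 1 - A 3 $ 1 * A 1 $ 3)
    + h 3 * (A 1 $ 3 * A 2 $ 1 - A 1 $ 1 * A 2 $ 3)"
  "F 3 = h 1 * (A 2 $ 1 * A 3 $ 2 - A 2 $ 2 * A 3 $ 1) + h 2 * (A 3 $ 1 * A 1 $ 2 - A 3 $ 2 * A 1 $ 1)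
    + h 3 * (A 1 $ 1 * A 2 $ 2 - A 1 $ 2 * A 2 $ 1)"
proof -
  note cb = cauchy_binet_2[of "\<lambda>k. A k $ i" "\<lambda>k. r k $ p" "\<lambda>k. A k $ j" "\<lambda>k. r k $ q" for i j p q]
  show "F 1 = h 1 * (A 2 $ 2 * A 3 $ 3 - A 2 $ 3 * A 3 $ 2) + h 2 * (A 3 $ 2 * A 1 $ 3 - A 3 $ 3 * A 1 $ 2)
    + h 3 * (A 1 $ 2 * A 2 $ 3 - A 1 $ 3 * A 2 $ 2)" (is "_ = ?R")
  proof (rule F_cancel)
    have "F 1 * F 1 = F 1 * ?R" "F 2 * F 1 = F 2 * ?R" "F 3 * F 1 = F 3 * ?R"
      using cb[of 2 2 3 3] cb[of 2 3 3 1] cb[of 2 1 3 2]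
      unfolding koszul_entries h1 h2 h3 by (simp_all add: algebra_simps)
    then show "F j * F 1 = F j * ?R" for j
      using exhaust_3[of j] by blast
  qed
  show "F 2 = h 1 * (A 2 $ 3 * A 3 $ 1 - A 2 $ 1 * A 3 $ 3) + h 2 * (A 3 $ 3 * A 1 $ 1 - A 3 $ 1 * A 1 $ 3)
    + h 3 * (A 1 $ 3 * A 2 $ 1 - A 1 $ 1 * A 2 $ 3)" (is "_ = ?R")
  proof (rule F_cancel)
    have "F 1 * F 2 = F 1 * ?R" "F 2 * F 2 = F 2 * ?R" "F 3 * F 2 = F 3 * ?R"
      using cb[of 3 2 1 3] cb[of 3 3 1 1] cb[of 3 1 1 2]
      unfolding koszul_entries h1 h2 h3 by (simp_all add: algebra_simps)
    then show "F j * F 2 = F j * ?R" for j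
      using exhaust_3[of j] by blast
  qed
  show "F 3 = h 1 * (A 2 $ 1 * A 3 $ 2 - A 2 $ 2 * A 3 $ 1) + h 2 * (A 3 $ 1 * A 1 $ 2 - A 3 $ 2 * A 1 $ 1)
    + h 3 * (A 1 $ 1 * A 2 $ 2 - A 1 $ 2 * A 2 $ 1)" (is "_ = ?R")
  proof (rule F_cancel)
    have "F 1 * F 3 = F 1 * ?R" "F 2 * F 3 = F 2 * ?R" "F 3 * F 3 = F 3 * ?R"
      using cb[of 1 2 2 3] cb[of 1 3 2 1] cb[of 1 1 2 2]
      unfolding koszul_entries h1 h2 h3 by (simp_all add: algebra_simps)
    then show "F j * F 3 = F j * ?R" for j
      using exhaust_3[of j] by blast
  qed
qed

text \<open>Each \<open>F j\<close> is a combination of the \<open>h i\<close>, so coprimality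
  passes from \<open>F\<close> to \<open>h\<close>.\<close>

lemma h_coprime: "(\<And>i. p dvd h i) \<Longrightarrow> p dvd 1"
proof (rule F_coprime)
  fix i assume "\<And>i. p dvd h i"
  then have "\<forall>i. p dvd F i"
    unfolding forall_3 F_eq_minors by (auto intro!: dvd_add)
  then show "p dvd F i" by blast
qed

lemma h_relation: "(\<Sum>i\<in>UNIV. h i *s r i) = 0"
proof -
  \<comment> \<open>The determinant of \<open>R\<close> expanded along \<open>r 1\<close>; it is
    \<open>h 1\<close> times the pairing of \<open>r 1\<close> with \<open>F\<close>.\<close>
  have det: "r 1 $ 1 * (h 1 * F 1) + r 1 $ 2 * (h 1 * F 2) + r 1 $ 3 * (h 1 * F 3) = 0"
    using r_syz[of 1] by algebra
  \<comment> \<open>The \<open>h i * F j\<close> are the cofactors of \<open>R\<close>, so this is a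
    cofactor expansion: the determinant if \<open>l = j\<close>, and one with a repeated coordinate
    otherwise.\<close>
  have "\<forall>l j. F j * (h 1 * r 1 $ l + h 2 * r 2 $ l + h 3 * r 3 $ l) = F j * 0"
    unfolding forall_3 using det h1 h2 h3 by (intro conjI; algebra)
  then have "\<forall>l. h 1 * r 1 $ l + h 2 * r 2 $ l + h 3 * r 3 $ l = 0"
    using F_cancel by blast
  then show ?thesis
    by (simp add: vec_eq_iff sum_3)
qed

end

section \<open>The determinant \<open>u\<close>, the colon ideal and the syzygies of
  \<open>F\<close> and \<open>u\<close>\<close>

context three_syzygies_minors
begin

definition u :: poly3 where
  "u = A 1 $ 1 * (A 2 $ 2 * A 3 $ 3 - A 2 $ 3 * A 3 $ 2) + A 1 $ 2 * (A 2 $ 3 * A 3 $ 1 - A 2 $ 1 * A 3 $ 3)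
    + A 1 $ 3 * (A 2 $ 1 * A 3 $ 2 - A 2 $ 2 * A 3 $ 1)"

lemma u_deg: "u \<in> S_comp (3 * D - (\<Sum>i\<in>UNIV. \<delta> i))"
proof -
  have A: "A i $ j \<in> S_comp (D - \<delta> i)" for i j
    using A_deg by (simp add: S3_comp_def)
  have "x * (y * z - y' * z') \<in> S_comp (3 * D - (\<Sum>i\<in>UNIV. \<delta> i))"
    if "x \<in> S_comp (D - \<delta> 1)" "y \<in> S_comp (D - \<delta> 2)" "y' \<in> S_comp (D - \<delta> 2)"
      "z \<in> S_comp (D - \<delta> 3)" "z' \<in> S_comp (D - \<delta> 3)" for x y z y' z'
  proof -
    have "x * (y * z - y' * z') \<in> S_comp ((D - \<delta> 1) + ((D - \<delta> 2) + (D - \<delta> 3)))"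
      using that by (intro S_comp_mult S_comp_diff) auto
    moreover have "(D - \<delta> 1) + ((D - \<delta> 2) + (D - \<delta> 3)) = 3 * D - (\<Sum>i\<in>UNIV. \<delta> i)"
      by (simp add: sum_3)
    ultimately show ?thesis by (simp only:)
  qed
  then show ?thesis
    unfolding u_def using A by (intro S_comp_add) auto
qed

text \<open>\<open>F_eq_minors\<close> says that \<open>F\<close> is the adjugate of
  \<open>A\<close> applied to \<open>h\<close>; multiplication by \<open>A\<close> turns the
  adjugate into the determinant.\<close>

lemma u_h: "A i $ 1 * F 1 + A i $ 2 * F 2 + A i $ 3 * F 3 = u * h i"
proof -
  have "A 1 $ 1 * F 1 + A 1 $ 2 * F 2 + A 1 $ 3 * F 3 = u * h 1"
    "A 2 $ 1 * F 1 + A 2 $ 2 * F 2 + A 2 $ 3 * F 3 = u * h 2"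
    "A 3 $ 1 * F 1 + A 3 $ 2 * F 2 + A 3 $ 3 * F 3 = u * h 3"
    unfolding F_eq_minors u_def by (simp_all add: algebra_simps)
  then show ?thesis
    using exhaust_3[of i] by blast
qed

lemma h_relation_entry: "h 1 * r 1 $ l + h 2 * r 2 $ l + h 3 * r 3 $ l = 0"
  using h_relation by (simp add: vec_eq_iff sum_3)

lemma h_nonunit: "\<not> h i dvd 1"
  using r_minimal[OF h_relation] .

lemma h_const_term: "lkp (h i) 0 = 0"
  using S_comp_0_nonunit[OF h_deg h_nonunit] .

text \<open>After multiplication by \<open>F j\<close> the \<open>h i\<close> become minors of the
  syzygies, and the proportionality of \<open>v\<close> and \<open>h\<close> is Cramer's rule for
  the given relation. Coprimality of \<open>h\<close> makes the factor a polynomial.\<close>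

lemma relation_multiple:
  assumes "(\<Sum>i\<in>UNIV. v i *s r i) = 0"
  obtains c where "\<And>i. v i = c * h i"
proof -
  have e: "v 1 * r 1 $ l + v 2 * r 2 $ l + v 3 * r 3 $ l = 0" for l
    using assms by (simp add: vec_eq_iff sum_3)
  have 12: "v 1 * h 2 = v 2 * h 1"
  proof (rule F_cancel)
    have "F 1 * (v 1 * h 2) = F 1 * (v 2 * h 1)" "F 2 * (v 1 * h 2) = F 2 * (v 2 * h 1)"
      "F 3 * (v 1 * h 2) = F 3 * (v 2 * h 1)"
      using e[of 1] e[of 2] e[of 3] h1 h2 h3 by algebra+
    then show "F j * (v 1 * h 2) = F j * (v 2 * h 1)" for j
      using exhaust_3[of j] by blast
  qed
  have 13: "v 1 * h 3 = v 3 * h 1"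
  proof (rule F_cancel)
    have "F 1 * (v 1 * h 3) = F 1 * (v 3 * h 1)" "F 2 * (v 1 * h 3) = F 2 * (v 3 * h 1)"
      "F 3 * (v 1 * h 3) = F 3 * (v 3 * h 1)"
      using e[of 1] e[of 2] e[of 3] h1 h2 h3 by algebra+
    then show "F j * (v 1 * h 3) = F j * (v 3 * h 1)" for j
      using exhaust_3[of j] by blast
  qed
  have 23: "v 2 * h 3 = v 3 * h 2"
  proof (rule F_cancel)
    have "F 1 * (v 2 * h 3) = F 1 * (v 3 * h 2)" "F 2 * (v 2 * h 3) = F 2 * (v 3 * h 2)"
      "F 3 * (v 2 * h 3) = F 3 * (v 3 * h 2)"
      using e[of 1] e[of 2] e[of 3] h1 h2 h3 by algebra+
    then show "F j * (v 2 * h 3) = F j * (v 3 * h 2)" for j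
      using exhaust_3[of j] by blast
  qed
  have "\<forall>i j. v i * h j = v j * h i"
    unfolding forall_3 using 12 13 23 by (simp add: mult.commute)
  then show ?thesis
    using coprime_family_proportional[of h v] h_coprime that by blast
qed

text \<open>The ideal quotient \<open>J : u\<close> is generated by the \<open>h i\<close>. The rows \<open>s A\<^sub>i - h\<^sub>i w\<close> are syzygies, so
  \<open>s [F] = R B R\<^sup>T\<close> for some matrix \<open>B\<close>; since \<open>[F]\<close> is skew-symmetric, so may \<open>B\<close> be taken, and then
  the right-hand side is a combination of cross products of the generators.\<close>

lemma colon:
  fixes w :: "poly3 ^ 3"
  assumes "s * u = w $ 1 * F 1 + w $ 2 * F 2 + w $ 3 * F 3"
  obtains \<beta> where "s = \<beta> 1 * h 1 + \<beta> 2 * h 2 + \<beta> (3::3) * h 3"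
proof -
  have "\<exists>c. s *s A i - h i *s w = (\<Sum>l\<in>UNIV. c l *s r l)" for i
  proof -
    have "(\<Sum>l\<in>UNIV. (s *s A i - h i *s w) $ l * F l)
        = s * (A i $ 1 * F 1 + A i $ 2 * F 2 + A i $ 3 * F 3) - h i * (w $ 1 * F 1 + w $ 2 * F 2 + w $ 3 * F 3)"
      by (simp add: sum_3 algebra_simps)
    also have "\<dots> = 0"
      by (simp add: u_h flip: assms)
    finally show ?thesis
      using r_generate by blast
  qed
  then obtain B where B: "\<And>i. s *s A i - h i *s w = (\<Sum>l\<in>UNIV. B i l *s r l)"
    by metis
  have B': "s * A i $ q - h i * w $ q = B i 1 * r 1 $ q + B i 2 * r 2 $ q + B i 3 * r 3 $ q" for i q
    using arg_cong[OF B[of i], of "\<lambda>x. x $ q"] by (simp add: sum_3)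
  let ?b1 = "B 2 3 - B 3 2" and ?b2 = "B 3 1 - B 1 3" and ?b3 = "B 1 2 - B 2 1"
  \<comment> \<open>Multiplication by \<open>R\<close> removes the terms \<open>h i * w\<close>,
    because \<open>R\<close> annihilates \<open>h\<close>.\<close>
  have K: "s * (A 1 $ q * r 1 $ p + A 2 $ q * r 2 $ p + A 3 $ q * r 3 $ p) =
     (B 1 1 * r 1 $ q + B 1 2 * r 2 $ q + B 1 3 * r 3 $ q) * r 1 $ p
     + (B 2 1 * r 1 $ q + B 2 2 * r 2 $ q + B 2 3 * r 3 $ q) * r 2 $ p
     + (B 3 1 * r 1 $ q + B 3 2 * r 2 $ q + B 3 3 * r 3 $ q) * r 3 $ p" for p q
  proof -
    have "s * (A 1 $ q * r 1 $ p + A 2 $ q * r 2 $ p + A 3 $ q * r 3 $ p)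
      = (s * A 1 $ q - h 1 * w $ q) * r 1 $ p + (s * A 2 $ q - h 2 * w $ q) * r 2 $ p
        + (s * A 3 $ q - h 3 * w $ q) * r 3 $ p + (h 1 * r 1 $ p + h 2 * r 2 $ p + h 3 * r 3 $ p) * w $ q"
      by (simp add: algebra_simps)
    then show ?thesis
      by (simp only: B' h_relation_entry mult_zero_left add_0_right)
  qed
  have skew: "s * (A 1 $ q * r 1 $ p + A 2 $ q * r 2 $ p + A 3 $ q * r 3 $ p)
      - s * (A 1 $ p * r 1 $ q + A 2 $ p * r 2 $ q + A 3 $ p * r 3 $ q)
    = ?b1 * (r 2 $ p * r 3 $ q - r 2 $ q * r 3 $ p) + ?b2 * (r 3 $ p * r 1 $ q - r 3 $ q * r 1 $ p)
      + ?b3 * (r 1 $ p * r 2 $ q - r 1 $ q * r 2 $ p)" for p q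
    unfolding K by (simp add: algebra_simps)
  \<comment> \<open>The factor 2 stems from subtracting the transpose, which counts each entry of
    the skew-symmetric matrix of \<open>F\<close> twice.\<close>
  have "2 * s = ?b1 * h 1 + ?b2 * h 2 + ?b3 * h 3"
  proof (rule F_cancel)
    have "F 1 * (2 * s) = F 1 * (?b1 * h 1 + ?b2 * h 2 + ?b3 * h 3)"
      "F 2 * (2 * s) = F 2 * (?b1 * h 1 + ?b2 * h 2 + ?b3 * h 3)"
      "F 3 * (2 * s) = F 3 * (?b1 * h 1 + ?b2 * h 2 + ?b3 * h 3)"
      using skew[of 3 2] skew[of 1 3] skew[of 2 1] unfolding koszul_entries h1 h2 h3
      by (simp_all add: algebra_simps)
    then show "F j * (2 * s) = F j * (?b1 * h 1 + ?b2 * h 2 + ?b3 * h 3)" for j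
      using exhaust_3[of j] by blast
  qed
  moreover have half: "Poly_Mapping.single 0 (1 / 2 :: complex) * (2 * p) = p" for p :: poly3
  proof -
    have "Poly_Mapping.single (0 :: 3 \<Rightarrow>\<^sub>0 nat) (1 / 2 :: complex) * Poly_Mapping.single 0 2 = 1"
      unfolding mult_single by simp
    then show ?thesis
      by (simp flip: mult.assoc)
  qed
  ultimately have "s = Poly_Mapping.single 0 (1 / 2 :: complex) * (?b1 * h 1 + ?b2 * h 2 + ?b3 * h 3)"
    by metis
  then show ?thesis
    by (intro that[of "\<lambda>i. Poly_Mapping.single 0 (1 / 2 :: complex) * (if i = 1 then ?b1 else if i = 2 then ?b2 else ?b3)"])
      (simp add: algebra_simps)
qed

text \<open>For \<open>u = 0\<close> the colon ideal would contain 1, but it is generated by the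
  \<open>h i\<close>, which vanish at the origin.\<close>

lemma u_nonzero: "u \<noteq> 0"
proof
  assume "u = 0"
  then obtain \<beta> where e: "1 = \<beta> 1 * h 1 + \<beta> 2 * h 2 + \<beta> (3::3) * h 3"
    using colon[of 1 0] by auto
  show False
    using arg_cong[OF e, of "\<lambda>p. lkp p 0"] by (simp add: lookup_add lookup_0_mult h_const_term)
qed

lemma A_independent:
  assumes "\<And>j. y 1 * A 1 $ j + y 2 * A 2 $ j + y (3::3) * A 3 $ j = 0"
  shows "y i = 0"
proof -
  have "y 1 * u = 0" "y 2 * u = 0" "y 3 * u = 0"
    using assms[of 1] assms[of 2] assms[of 3] unfolding u_def by algebra+
  then show ?thesis
    using u_nonzero exhaust_3[of i] by auto
qed

text \<open>Since \<open>A\<close> has nonzero determinant, both sides may be compared after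
  multiplication by \<open>A\<close>, where both become the skew-symmetric matrix of
  \<open>F\<close>. Each \<open>r k\<close> is thereby a combination of the rows of \<open>A\<close>
  with coefficients orthogonal to \<open>h\<close>.\<close>

lemma r_eq_minors:
  "r 1 $ j = h 2 * A 3 $ j - h 3 * A 2 $ j"
  "r 2 $ j = h 3 * A 1 $ j - h 1 * A 3 $ j"
  "r 3 $ j = h 1 * A 2 $ j - h 2 * A 1 $ j"
proof -
  define y where "y = (\<lambda>p (k::3). (if k = 1 then h 2 * A 3 $ p - h 3 * A 2 $ p
     else if k = 2 then h 3 * A 1 $ p - h 1 * A 3 $ p else h 1 * A 2 $ p - h 2 * A 1 $ p) - r k $ p)"
  have y: "y p 1 = h 2 * A 3 $ p - h 3 * A 2 $ p - r 1 $ p"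
    "y p 2 = h 3 * A 1 $ p - h 1 * A 3 $ p - r 2 $ p"
    "y p 3 = h 1 * A 2 $ p - h 2 * A 1 $ p - r 3 $ p" for p
    by (simp_all add: y_def)
  have "\<forall>p q. y p 1 * A 1 $ q + y p 2 * A 2 $ q + y p 3 * A 3 $ q = 0"
  proof -
    have "y p 1 * A 1 $ q + y p 2 * A 2 $ q + y p 3 * A 3 $ q =
       h 1 * (A 2 $ p * A 3 $ q - A 2 $ q * A 3 $ p) + h 2 * (A 3 $ p * A 1 $ q - A 3 $ q * A 1 $ p)
       + h 3 * (A 1 $ p * A 2 $ q - A 1 $ q * A 2 $ p)
       - (A 1 $ q * r 1 $ p + A 2 $ q * r 2 $ p + A 3 $ q * r 3 $ p)" for p q
      unfolding y by (simp add: algebra_simps)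
    then show ?thesis
      by (simp add: forall_3 koszul_entries F_eq_minors) (simp add: algebra_simps)
  qed
  then have "y j k = 0" for k
    using A_independent[of "y j"] by blast
  from this[of 1] this[of 2] this[of 3] show
    "r 1 $ j = h 2 * A 3 $ j - h 3 * A 2 $ j"
    "r 2 $ j = h 3 * A 1 $ j - h 1 * A 3 $ j"
    "r 3 $ j = h 1 * A 2 $ j - h 2 * A 1 $ j"
    unfolding y by simp_all
qed

text \<open>The colon ideal lets multiples of the rows \<open>(A i, - h i)\<close> cancel the
  coefficient of \<open>u\<close>. What remains is a syzygy of \<open>F\<close>, hence a combination
  of the \<open>r k\<close>, and \<open>r_eq_minors\<close> writes these through the same
  rows.\<close>

lemma extended_syzygy:
  fixes w :: "poly3 ^ 3"
  assumes "w $ 1 * F 1 + w $ 2 * F 2 + w $ 3 * F 3 + s * u = 0"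
  obtains c where "w = (\<Sum>i\<in>UNIV. c i *s A i)" "s = - (c 1 * h 1 + c 2 * h 2 + c (3::3) * h 3)"
proof -
  have "s * u = (- w) $ 1 * F 1 + (- w) $ 2 * F 2 + (- w) $ 3 * F 3"
    using assms by (simp add: algebra_simps eq_neg_iff_add_eq_0)
  then obtain \<beta> where \<beta>: "s = \<beta> 1 * h 1 + \<beta> 2 * h 2 + \<beta> (3::3) * h 3"
    by (rule colon)
  define w' where "w' = w + (\<Sum>i\<in>UNIV. \<beta> i *s A i)"
  have "(\<Sum>l\<in>UNIV. w' $ l * F l) = w $ 1 * F 1 + w $ 2 * F 2 + w $ 3 * F 3
      + \<beta> 1 * (A 1 $ 1 * F 1 + A 1 $ 2 * F 2 + A 1 $ 3 * F 3)
      + \<beta> 2 * (A 2 $ 1 * F 1 + A 2 $ 2 * F 2 + A 2 $ 3 * F 3)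
      + \<beta> 3 * (A 3 $ 1 * F 1 + A 3 $ 2 * F 2 + A 3 $ 3 * F 3)"
    by (simp add: w'_def sum_3 algebra_simps)
  also have "\<dots> = w $ 1 * F 1 + w $ 2 * F 2 + w $ 3 * F 3 + s * u"
    unfolding u_h \<beta> by (simp add: algebra_simps)
  finally have "(\<Sum>l\<in>UNIV. w' $ l * F l) = 0"
    using assms by simp
  then obtain \<gamma> where \<gamma>: "w' = (\<Sum>k\<in>UNIV. \<gamma> k *s r k)"
    using r_generate by blast
  \<comment> \<open>The cross product of \<open>\<gamma>\<close> and \<open>h\<close>, minus
    \<open>\<beta>\<close>; the cross product is orthogonal to \<open>h\<close> and so does not
    affect \<open>s\<close>.\<close>
  define c where "c = (\<lambda>i::3. if i = 1 then \<gamma> 2 * h 3 - \<gamma> 3 * h 2 - \<beta> 1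
    else if i = 2 then \<gamma> 3 * h 1 - \<gamma> 1 * h 3 - \<beta> 2 else \<gamma> 1 * h 2 - \<gamma> 2 * h 1 - \<beta> 3)"
  have c: "c 1 = \<gamma> 2 * h 3 - \<gamma> 3 * h 2 - \<beta> 1" "c 2 = \<gamma> 3 * h 1 - \<gamma> 1 * h 3 - \<beta> 2"
    "c 3 = \<gamma> 1 * h 2 - \<gamma> 2 * h 1 - \<beta> 3"
    by (simp_all add: c_def)
  have "w $ l = c 1 * A 1 $ l + c 2 * A 2 $ l + c 3 * A 3 $ l" for l
  proof -
    have "w = (\<Sum>k\<in>UNIV. \<gamma> k *s r k) - (\<Sum>i\<in>UNIV. \<beta> i *s A i)"
      using \<gamma> unfolding w'_def by (simp only: eq_diff_eq)
    then have "w $ l = ((\<Sum>k\<in>UNIV. \<gamma> k *s r k) - (\<Sum>i\<in>UNIV. \<beta> i *s A i)) $ l"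
      by (rule arg_cong)
    also have "\<dots> = c 1 * A 1 $ l + c 2 * A 2 $ l + c 3 * A 3 $ l"
      by (simp add: sum_3 c r_eq_minors algebra_simps)
    finally show ?thesis .
  qed
  then have "w = (\<Sum>i\<in>UNIV. c i *s A i)"
    by (simp add: vec_eq_iff sum_3)
  moreover have "s = - (c 1 * h 1 + c 2 * h 2 + c 3 * h 3)"
    by (simp add: \<beta> c algebra_simps)
  ultimately show ?thesis
    using that by blast
qed

text \<open>If \<open>h 3\<close> vanished, then \<open>r 1\<close> and \<open>r 2\<close> would be multiples of a common syzygy, against minimality.\<close>

lemma h3_nonzero: "h 3 \<noteq> 0"
proof
  assume h30: "h 3 = 0"
  have e: "h 1 * r 1 $ l = - (h 2 * r 2 $ l)" for l
    using h_relation_entry[of l] h30 by (simp add: eq_neg_iff_add_eq_0)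
  have r2: "\<exists>l. r 2 $ l \<noteq> 0"
  proof (rule ccontr)
    assume "\<nexists>l. r 2 $ l \<noteq> 0"
    then have "(\<Sum>i\<in>UNIV. (if i = 2 then 1 else 0) *s r i) = 0"
      by (simp add: vec_eq_iff sum_3)
    from r_minimal[OF this, of 2] show False by simp
  qed
  have h10: "h 1 \<noteq> 0"
  proof
    assume h10: "h 1 = 0"
    then have "h 2 = 0"
      using e r2 by auto
    then have "\<forall>i. 0 dvd h i"
      unfolding forall_3 using h10 h30 by simp
    then show False
      using h_coprime[of 0] by auto
  qed
  \<comment> \<open>\<open>h 1\<close> divides \<open>r 2 $ l * h i\<close> for every
    \<open>i\<close>: trivially for 1, by \<open>e\<close> for 2, and because \<open>h 3 = 0\<close>
    for 3.\<close>
  have "h 1 dvd r 2 $ l" for l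
  proof -
    have "\<forall>i. h 1 dvd r 2 $ l * h i"
      unfolding forall_3 using e[of l] h30 by (metis dvd_0_right dvd_minus_iff dvd_triv_left dvd_triv_right mult.commute mult_zero_right)
    then show ?thesis
      using poly3_dvd_coprime_family[of h "h 1" "r 2 $ l"] h_coprime by blast
  qed
  then obtain q where q: "\<And>l. r 2 $ l = h 1 * q l"
    unfolding dvd_def by metis
  define w where "w = (\<chi> l. q l)"
  have "h 1 * (q 1 * F 1 + q 2 * F 2 + q 3 * F 3) = 0"
    using r_syz[of 2] by (simp add: q algebra_simps)
  then have "(\<Sum>l\<in>UNIV. w $ l * F l) = 0"
    using h10 by (simp add: sum_3 w_def)
  then obtain \<gamma> where \<gamma>: "w = (\<Sum>k\<in>UNIV. \<gamma> k *s r k)"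
    using r_generate by blast
  \<comment> \<open>A relation whose second coefficient has constant term 1, whereas all relations
    are multiples of \<open>h\<close> and have no constant terms.\<close>
  define v where "v = (\<lambda>i::3. (if i = 2 then 1 else 0) - h 1 * \<gamma> i)"
  have "(\<Sum>i\<in>UNIV. v i *s r i) = r 2 - h 1 *s w"
    unfolding \<gamma> by (simp add: vec_eq_iff sum_3 v_def algebra_simps)
  also have "\<dots> = 0"
    by (simp add: vec_eq_iff q w_def)
  finally obtain c where c: "\<And>i. v i = c * h i"
    using relation_multiple by blast
  have "lkp (v 2) 0 = 0"
    unfolding c by (simp add: lookup_0_mult h_const_term)
  moreover have "lkp (v 2) 0 = 1"
    by (simp add: v_def lookup_minus lookup_0_mult h_const_term)
  ultimately show False by simp
qed

text \<open>\<open>h 3\<close> is nonzero, homogeneous and not constant. For the curve this is the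
  inequality \<open>d1 + d2 \<ge> d\<close>.\<close>

lemma h3_deg_pos: "\<delta> 1 + \<delta> 2 - D \<ge> 1"
proof -
  have deg: "h 3 \<in> S_comp (\<delta> 1 + \<delta> 2 - D)"
    using h_deg[of 3] by (simp add: sum_3)
  obtain m where m: "lkp (h 3) m \<noteq> 0"
    using h3_nonzero by (metis lookup_zero poly_mapping_eqI)
  then have "int (mdeg m) = \<delta> 1 + \<delta> 2 - D"
    using deg by (simp add: S_comp_iff)
  moreover have "m \<noteq> 0"
    using m h_const_term by auto
  then have "mdeg m \<noteq> 0" by simp
  ultimately show ?thesis by linarith
qed

end

section \<open>Koszul relations of the variables\<close>

lemma lookup_var3_mult_shift: "lkp (var3 i * p) (m + Poly_Mapping.single i 1) = lkp p m"
proof (induction p rule: poly_mapping_add_induct)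
  case (single n c)
  have "Poly_Mapping.single i 1 + n = m + Poly_Mapping.single i 1 \<longleftrightarrow> n = m"
    by (simp add: add.commute)
  then show ?case
    by (simp add: var3_def mult_single lookup_single when_def)
qed (simp add: distrib_left lookup_add)

lemma lookup_var3_mult_0:
  assumes "lkp m i = 0"
  shows "lkp (var3 i * p) m = 0"
proof (induction p rule: poly_mapping_add_induct)
  case (single n c)
  have "Poly_Mapping.single i 1 + n \<noteq> m"
    using assms by (auto simp: lookup_add)
  then show ?case
    by (simp add: var3_def mult_single lookup_single when_def)
qed (simp add: distrib_left lookup_add)

lemma var3_dvdI:
  assumes "\<And>m. lkp m i = 0 \<Longrightarrow> lkp p m = 0"
  shows "var3 i dvd p"
proof -
  have "var3 i dvd (\<Sum>m\<in>Poly_Mapping.keys p. Poly_Mapping.single m (lkp p m))"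
  proof (rule dvd_sum)
    fix m assume "m \<in> Poly_Mapping.keys p"
    then have i: "lkp m i \<noteq> 0"
      using assms by (auto simp: in_keys_iff)
    have "m - Poly_Mapping.single i 1 + Poly_Mapping.single i 1 = m"
      unfolding monomial_minus_add[OF i] by simp
    then have "Poly_Mapping.single m (lkp p m) = var3 i * Poly_Mapping.single (m - Poly_Mapping.single i 1) (lkp p m)"
      by (simp add: var3_def mult_single add.commute)
    then show "var3 i dvd Poly_Mapping.single m (lkp p m)"
      by simp
  qed
  then show ?thesis
    by (simp flip: poly_mapping_sum_single)
qed

lemma var3_nonzero: "var3 i \<noteq> 0"
  by (metis lookup_single_eq lookup_zero var3_def zero_neq_one)

lemma var3_relation_2:
  assumes "i \<noteq> j" and rel: "var3 i * p = var3 j * q"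
  obtains c where "p = var3 j * c" "q = var3 i * c"
proof -
  have "var3 i dvd q"
  proof (rule var3_dvdI)
    fix m :: "3 \<Rightarrow>\<^sub>0 nat" assume "lkp m i = 0"
    then have "lkp (m + Poly_Mapping.single j 1) i = 0"
      using \<open>i \<noteq> j\<close> by (simp add: lookup_add lookup_single when_def)
    then show "lkp q m = 0"
      using lookup_var3_mult_shift[of j q m] lookup_var3_mult_0 unfolding rel[symmetric] by metis
  qed
  then obtain c where c: "q = var3 i * c"
    by blast
  have "var3 i * p = var3 i * (var3 j * c)"
    using rel c by (simp add: mult_ac)
  then have "p = var3 j * c"
    using var3_nonzero by simp
  then show ?thesis
    using c that by blast
qed

lemma var3_relation_1:
  assumes "var3 1 * v 2 = var3 2 * v 1" "var3 2 * v 3 = var3 3 * v (2::3)"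
  obtains c where "\<And>i. v i = var3 i * c"
proof -
  have "(1::3) \<noteq> 2" by simp
  from this assms(1) obtain c where c: "v 2 = var3 2 * c" "v 1 = var3 1 * c"
    by (rule var3_relation_2)
  have "var3 2 * v 3 = var3 2 * (var3 3 * c)"
    using assms(2) c(1) by (simp add: mult_ac)
  then have "v 3 = var3 3 * c"
    using var3_nonzero[of 2] by simp
  with c have "\<forall>i. v i = var3 i * c"
    by (simp add: forall_3)
  then show ?thesis
    using that by blast
qed

text \<open>Exactness of the Koszul complex of the variables: a relation is a cross product with
  them. Writing \<open>v3\<close> in terms of the first two variables reduces it to a relation
  between these two.\<close>

lemma var3_relation_3:
  assumes rel: "var3 1 * v1 + var3 2 * v2 + var3 3 * v3 = 0"
  obtains q1 q2 q3 where "v1 = var3 2 * q3 - var3 3 * q2" "v2 = var3 3 * q1 - var3 1 * q3"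
    "v3 = var3 1 * q2 - var3 2 * q1"
proof -
  \<comment> \<open>The terms of \<open>v3\<close> free of variable 1. By \<open>rel\<close> every
    term of \<open>v3\<close> involves variable 1 or 2, so \<open>p\<close> is divisible by variable
    2 and \<open>v3 - p\<close> by variable 1.\<close>
  define p where "p = Poly_Mapping.mapp (\<lambda>m c. c when lkp m 1 = 0) v3"
  have p: "lkp p m = (lkp v3 m when lkp m 1 = 0)" for m
    by (auto simp: p_def lookup_mapp when_def in_keys_iff)
  have v3: "lkp v3 m = 0" if "lkp m 1 = 0" "lkp m 2 = 0" for m
  proof -
    have "lkp (m + Poly_Mapping.single 3 1) 1 = 0" "lkp (m + Poly_Mapping.single 3 1) 2 = 0"
      using that by (simp_all add: lookup_add lookup_single)
    then have "lkp (var3 1 * v1 + var3 2 * v2 + var3 3 * v3) (m + Poly_Mapping.single 3 1) = lkp v3 m"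
      by (simp only: lookup_add[of "_ :: poly3"] lookup_var3_mult_0 lookup_var3_mult_shift add_0_left)
    then show ?thesis
      using rel by simp
  qed
  have "var3 2 dvd p"
    by (rule var3_dvdI) (auto simp: p v3 when_def)
  then obtain b where b: "p = var3 2 * b"
    by blast
  have "var3 1 dvd v3 - p"
    by (rule var3_dvdI) (auto simp: p lookup_minus when_def)
  then obtain a where a: "v3 - p = var3 1 * a"
    by blast
  have v3_eq: "v3 = var3 1 * a + var3 2 * b"
    using a b by (simp add: algebra_simps)
  have "var3 1 * (v1 + var3 3 * a) + var3 2 * (v2 + var3 3 * b) = 0"
    using rel unfolding v3_eq by (simp add: algebra_simps)
  then have "var3 1 * (v1 + var3 3 * a) = var3 2 * - (v2 + var3 3 * b)"
    unfolding mult_minus_right by (simp only: eq_neg_iff_add_eq_0)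
  moreover have "(1::3) \<noteq> 2" by simp
  ultimately obtain c where "v1 + var3 3 * a = var3 2 * c" "- (v2 + var3 3 * b) = var3 1 * c"
    using var3_relation_2 by metis
  then have "v1 = var3 2 * c - var3 3 * a" "v2 = var3 3 * (- b) - var3 1 * c"
    by (simp_all add: algebra_simps eq_neg_iff_add_eq_0 neg_eq_iff_add_eq_0)
  moreover have "v3 = var3 1 * a - var3 2 * (- b)"
    by (simp add: v3_eq)
  ultimately show ?thesis
    using that by blast
qed

section \<open>Saturatedness of J + (u)\<close>

context three_syzygies_minors
begin

definition Q :: "poly3 set" where
  "Q = {g. \<exists>w s. g = w 1 * F 1 + w 2 * F 2 + w (3::3) * F 3 + s * u}"

lemma extended_syzygy':
  assumes "w 1 * F 1 + w 2 * F 2 + w (3::3) * F 3 + s * u = 0"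
  shows "\<exists>c. (\<forall>l. w l = c 1 * A 1 $ l + c 2 * A 2 $ l + c (3::3) * A 3 $ l)
     \<and> s = - (c 1 * h 1 + c 2 * h 2 + c 3 * h 3)"
proof -
  obtain c where "(\<chi> l. w l) = (\<Sum>i\<in>UNIV. c i *s A i)" "s = - (c 1 * h 1 + c 2 * h 2 + c (3::3) * h 3)"
    by (rule extended_syzygy[of "\<chi> l. w l" s]) (use assms in simp_all)
  then show ?thesis
    by (intro exI[of _ c]) (simp add: vec_eq_iff sum_3)
qed

text \<open>The quotient by \<open>Q\<close> has a free resolution of length two, so its depth is positive; the
  argument compares this resolution with the Koszul complex of the variables.\<close>

lemma Q_saturated:
  assumes "\<And>i. var3 i * g \<in> Q"
  shows "g \<in> Q"
proof -
  have "\<forall>i. \<exists>w s. var3 i * g = w 1 * F 1 + w 2 * F 2 + w (3::3) * F 3 + s * u"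
    using assms unfolding Q_def by blast
  then obtain w s where ws: "\<And>i. var3 i * g = w i 1 * F 1 + w i 2 * F 2 + w i (3::3) * F 3 + s i * u"
    by metis
  \<comment> \<open>The two expressions for \<open>var3 i * var3 j * g\<close> differ by a syzygy of
    \<open>F\<close> and \<open>u\<close>, hence by a combination of the rows with coefficients
    \<open>c i j\<close>.\<close>
  have "\<exists>c. (\<forall>l. var3 i * w j l - var3 j * w i l = c 1 * A 1 $ l + c 2 * A 2 $ l + c (3::3) * A 3 $ l)
     \<and> var3 i * s j - var3 j * s i = - (c 1 * h 1 + c 2 * h 2 + c 3 * h 3)" for i j
  proof (rule extended_syzygy')
    have "(var3 i * w j 1 - var3 j * w i 1) * F 1 + (var3 i * w j 2 - var3 j * w i 2) * F 2
        + (var3 i * w j 3 - var3 j * w i 3) * F 3 + (var3 i * s j - var3 j * s i) * u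
      = var3 i * (w j 1 * F 1 + w j 2 * F 2 + w j (3::3) * F 3 + s j * u)
        - var3 j * (w i 1 * F 1 + w i 2 * F 2 + w i (3::3) * F 3 + s i * u)"
      by (simp add: algebra_simps)
    also have "\<dots> = 0"
      by (simp flip: ws)
    finally show "(var3 i * w j 1 - var3 j * w i 1) * F 1 + (var3 i * w j 2 - var3 j * w i 2) * F 2
        + (var3 i * w j 3 - var3 j * w i 3) * F 3 + (var3 i * s j - var3 j * s i) * u = 0" .
  qed
  then obtain c where
    c1: "\<And>i j l. var3 i * w j l - var3 j * w i l
      = c i j 1 * A 1 $ l + c i j 2 * A 2 $ l + c i j (3::3) * A 3 $ l"
    and c2: "\<And>i j. var3 i * s j - var3 j * s i = - (c i j 1 * h 1 + c i j 2 * h 2 + c i j 3 * h 3)"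
    by metis
  \<comment> \<open>The cyclic sum of the differences vanishes identically, and independence of the
    rows of \<open>A\<close> carries this over to the \<open>c i j\<close>, which are therefore a
    Koszul boundary.\<close>
  have "var3 1 * c 2 3 k + var3 2 * c 3 1 k + var3 3 * c 1 2 k = 0" for k
  proof -
    have "(var3 1 * c 2 3 1 + var3 2 * c 3 1 1 + var3 3 * c 1 2 1) * A 1 $ l
      + (var3 1 * c 2 3 2 + var3 2 * c 3 1 2 + var3 3 * c 1 2 2) * A 2 $ l
      + (var3 1 * c 2 3 3 + var3 2 * c 3 1 3 + var3 3 * c 1 2 3) * A 3 $ l
      = var3 1 * (var3 2 * w 3 l - var3 3 * w 2 l) + var3 2 * (var3 3 * w 1 l - var3 1 * w 3 l)
        + var3 3 * (var3 1 * w 2 l - var3 2 * w 1 l)" for l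
      unfolding c1 by (simp add: algebra_simps)
    then have "(var3 1 * c 2 3 1 + var3 2 * c 3 1 1 + var3 3 * c 1 2 1) * A 1 $ l
      + (var3 1 * c 2 3 2 + var3 2 * c 3 1 2 + var3 3 * c 1 2 2) * A 2 $ l
      + (var3 1 * c 2 3 3 + var3 2 * c 3 1 3 + var3 3 * c 1 2 3) * A 3 $ l = 0" for l
      by (simp add: algebra_simps)
    then show ?thesis
      using A_independent[of "\<lambda>k. var3 1 * c 2 3 k + var3 2 * c 3 1 k + var3 3 * c 1 2 k"] by blast
  qed
  then have "\<exists>q1 q2 q3. c 2 3 k = var3 2 * q3 - var3 3 * q2 \<and> c 3 1 k = var3 3 * q1 - var3 1 * q3
    \<and> c 1 2 k = var3 1 * q2 - var3 2 * q1" for k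
    by (metis var3_relation_3)
  then obtain q1 q2 q3 where q: "\<And>k. c 2 3 k = var3 2 * q3 k - var3 3 * q2 k"
    "\<And>k. c 1 2 k = var3 1 * q2 k - var3 2 * q1 k"
    by metis
  define q where "q = (\<lambda>i::3. if i = 1 then q1 else if i = 2 then q2 else q3)"
  have qs: "q 1 = q1" "q 2 = q2" "q 3 = q3"
    by (simp_all add: q_def)
  define w' where "w' l i = w i l - (q i 1 * A 1 $ l + q i 2 * A 2 $ l + q i 3 * A 3 $ l)" for l i
  define s' where "s' i = s i + (q i 1 * h 1 + q i 2 * h 2 + q i 3 * h 3)" for i
  have "\<exists>c. \<forall>i. w' l i = var3 i * c" for l
  proof -
    have "var3 1 * w' l 2 = var3 2 * w' l 1"
      using c1[of 1 2 l] unfolding w'_def qs q by (simp add: algebra_simps)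
    moreover have "var3 2 * w' l 3 = var3 3 * w' l 2"
      using c1[of 2 3 l] unfolding w'_def qs q by (simp add: algebra_simps)
    ultimately show ?thesis
      by (metis var3_relation_1)
  qed
  then obtain W where W: "\<And>l i. w' l i = var3 i * W l"
    by metis
  have "var3 1 * s' 2 = var3 2 * s' 1"
    using c2[of 1 2] unfolding s'_def qs q by (simp add: algebra_simps)
  moreover have "var3 2 * s' 3 = var3 3 * s' 2"
    using c2[of 2 3] unfolding s'_def qs q by (simp add: algebra_simps)
  ultimately obtain T where T: "\<And>i. s' i = var3 i * T"
    using var3_relation_1 by metis
  have "var3 1 * g = w' 1 1 * F 1 + w' 2 1 * F 2 + w' 3 1 * F 3 + s' 1 * u
     + q 1 1 * ((A 1 $ 1 * F 1 + A 1 $ 2 * F 2 + A 1 $ 3 * F 3) - u * h 1)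
     + q 1 2 * ((A 2 $ 1 * F 1 + A 2 $ 2 * F 2 + A 2 $ 3 * F 3) - u * h 2)
     + q 1 3 * ((A 3 $ 1 * F 1 + A 3 $ 2 * F 2 + A 3 $ 3 * F 3) - u * h 3)"
    unfolding ws w'_def s'_def by (simp add: algebra_simps)
  also have "\<dots> = var3 1 * (W 1 * F 1 + W 2 * F 2 + W 3 * F 3 + T * u)"
    unfolding u_h W T by (simp add: algebra_simps)
  finally have "g = W 1 * F 1 + W 2 * F 2 + W 3 * F 3 + T * u"
    using var3_nonzero[of 1] by simp
  then show ?thesis
    unfolding Q_def by blast
qed

end

section \<open>Dimensions of graded pieces\<close>

context vector_space_pair
begin

text \<open>Rank-nullity for the restriction to \<open>V\<close>; the spaces to which it is applied
  have infinite dimension, so finiteness has to come from \<open>A\<close>.\<close>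

lemma dim_image_add_dim_kernel:
  assumes T: "Vector_Spaces.linear s1 s2 T" and V: "vs1.subspace V" and fin: "finite A" "V \<subseteq> vs1.span A"
  shows "vs2.dim (T ` V) + vs1.dim {v \<in> V. T v = 0} = vs1.dim V"
proof -
  interpret T: Vector_Spaces.linear s1 s2 T by fact
  let ?K = "{v \<in> V. T v = 0}"
  obtain C where C: "C \<subseteq> ?K" "vs1.independent C" "?K \<subseteq> vs1.span C"
    using vs1.maximal_independent_subset by blast
  obtain B where B: "C \<subseteq> B" "B \<subseteq> V" "vs1.independent B" "V \<subseteq> vs1.span B"
    using vs1.maximal_independent_subset_extend[of C V] C by blast
  have finB: "finite B"
    using vs1.independent_span_bound[OF fin(1) B(3)] B(2) fin(2) by blast
  then have finC: "finite C" and finD: "finite (B - C)"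
    using B(1) finite_subset by auto
  have spanV: "vs1.span (B - C) \<subseteq> V"
    using B(2) by (intro vs1.span_minimal V) blast
  have ker0: "v = 0" if v: "v \<in> vs1.span (B - C)" "T v = 0" for v
  proof -
    have "v \<in> vs1.span C"
      using v spanV C(3) by blast
    then obtain b where b: "v = (\<Sum>x\<in>C. b x *a x)"
      using vs1.span_finite[OF finC] by auto
    obtain a where a: "v = (\<Sum>x\<in>B - C. a x *a x)"
      using v(1) vs1.span_finite[OF finD] by auto
    let ?u = "\<lambda>x. if x \<in> C then - b x else a x"
    have "(\<Sum>x\<in>B. ?u x *a x) = (\<Sum>x\<in>B - C. ?u x *a x) + (\<Sum>x\<in>C. ?u x *a x)"
      by (rule sum.subset_diff[OF B(1) finB])
    also have "(\<Sum>x\<in>B - C. ?u x *a x) = v"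
      unfolding a by (rule sum.cong) auto
    also have "(\<Sum>x\<in>C. ?u x *a x) = - v"
      unfolding b by (simp add: sum_negf)
    finally have "(\<Sum>x\<in>B. ?u x *a x) = 0"
      by simp
    then have "?u x = 0" if "x \<in> B" for x
      using vs1.independentD[OF B(3) finB order_refl, of ?u] that by blast
    then have "a x = 0" if "x \<in> B - C" for x
      using that by (metis DiffE)
    then show "v = 0"
      unfolding a by simp
  qed
  have inj: "inj_on T (vs1.span (B - C))"
    using ker0 by (intro T.inj_on_iff_eq_0[THEN iffD2]) (auto simp: vs1.subspace_span)
  have ind: "vs2.independent (T ` (B - C))"
    by (rule T.independent_inj_on_image[OF vs1.independent_mono[OF B(3)] inj]) blast
  have "T ` V \<subseteq> vs2.span (T ` (B - C))"
  proof
    fix y assume "y \<in> T ` V"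
    then obtain v where v: "v \<in> vs1.span B" "y = T v"
      using B(4) by blast
    then have "y \<in> vs2.span (T ` B)"
      using T.span_image by blast
    moreover have "T ` B \<subseteq> vs2.span (T ` (B - C))"
    proof
      fix z assume "z \<in> T ` B"
      then obtain x where x: "x \<in> B" "z = T x" by blast
      show "z \<in> vs2.span (T ` (B - C))"
      proof (cases "x \<in> C")
        case True
        then have "z = 0" using C(1) x by blast
        then show ?thesis by (simp add: vs2.span_zero)
      next
        case False
        then show ?thesis using x by (intro vs2.span_base) blast
      qed
    qed
    ultimately show "y \<in> vs2.span (T ` (B - C))"
      using vs2.span_minimal[OF _ vs2.subspace_span] by blast
  qed
  then have "vs2.dim (T ` V) = card (T ` (B - C))"
    using B(2) ind by (intro vs2.dim_unique[OF _ _ _ refl]) auto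
  also have "\<dots> = card (B - C)"
    using inj_on_subset[OF inj vs1.span_superset] by (rule card_image)
  finally have "vs2.dim (T ` V) = card (B - C)" .
  moreover have "vs1.dim ?K = card C"
    using C by (intro vs1.dim_unique[OF _ _ _ refl]) auto
  moreover have "vs1.dim V = card B"
    using B by (intro vs1.dim_unique[OF _ _ _ refl]) auto
  moreover have "card B = card (B - C) + card C"
    using finB B(1) finC by (metis card_Diff_subset card_mono le_add_diff_inverse2)
  ultimately show ?thesis by simp
qed

end

section \<open>Graded pieces of free modules as complex vector spaces\<close>

definition vscale :: "complex \<Rightarrow> poly3 ^ 'n \<Rightarrow> poly3 ^ 'n" where
  "vscale c v = (\<chi> i. cscale c (v $ i))"

lemma vscale_nth [simp]: "vscale c v $ i = cscale c (v $ i)"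
  by (simp add: vscale_def)

interpretation vspace: vector_space vscale
  by unfold_locales (simp_all add: vec_eq_iff cspace.scale_right_distrib cspace.scale_left_distrib)

interpretation vv: vector_space_pair vscale vscale ..

interpretation vc: vector_space_pair vscale cscale ..

lemma lookup_cscale: "lkp (cscale c p) m = c * lkp p m"
  by (simp add: cscale_def Poly_Mapping.map.rep_eq when_def flip: mult_map_scale_conv_mult)

definition dim_S :: "int \<Rightarrow> nat" where
  "dim_S k = (if k < 0 then 0 else nat (k + 2) choose 2)"

lemma
  shows finite_monomials: "finite {m. mdeg m = n}"
    and card_monomials: "card {m. mdeg m = n} = (n + 2) choose 2"
proof -
  define \<phi> where "\<phi> = (\<lambda>m. (lkp m (1::3), lkp m 2) :: nat \<times> nat)"
  define \<psi> where "\<psi> = (\<lambda>(i, j). Poly_Mapping.single (1::3) i + Poly_Mapping.single 2 j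
    + Poly_Mapping.single 3 (n - i - j))"
  let ?T = "SIGMA i:{..n}. {..n - i}"
  have lk: "lkp (\<psi> (i, j)) 1 = i" "lkp (\<psi> (i, j)) 2 = j" "lkp (\<psi> (i, j)) 3 = n - i - j" for i j
    by (simp_all add: \<psi>_def lookup_add lookup_single)
  have "bij_betw \<phi> {m. mdeg m = n} ?T"
  proof (rule bij_betw_byWitness[of _ \<psi>])
    show "\<forall>m\<in>{m. mdeg m = n}. \<psi> (\<phi> m) = m"
      by (auto simp: \<phi>_def poly_mapping_eq_iff fun_eq_iff forall_3 lk mdeg_def sum_3)
    show "\<forall>x\<in>?T. \<phi> (\<psi> x) = x"
      by (auto simp: \<phi>_def lk)
    show "\<phi> ` {m. mdeg m = n} \<subseteq> ?T"
      by (auto simp: \<phi>_def mdeg_def sum_3)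
    show "\<psi> ` ?T \<subseteq> {m. mdeg m = n}"
      by (auto simp: lk mdeg_def sum_3)
  qed
  then have "finite {m. mdeg m = n} \<and> card {m. mdeg m = n} = card ?T"
    using bij_betw_finite bij_betw_same_card by fastforce
  moreover have "card ?T = (\<Sum>i\<le>n. n - i + 1)"
    by (subst card_SigmaI) auto
  moreover have "(\<Sum>i\<le>n. n - i + 1) = (\<Sum>i\<le>n. i + 1)"
    by (rule sum.reindex_bij_witness[of _ "\<lambda>i. n - i" "\<lambda>i. n - i"]) auto
  moreover have "(\<Sum>i\<le>n. i + 1) = (n + 2) choose 2"
    by (induction n) (auto simp: numeral_2_eq_2)
  ultimately show "finite {m. mdeg m = n}" "card {m. mdeg m = n} = (n + 2) choose 2"
    by auto
qed

lemma
  shows finite_monomials_int: "finite {m. int (mdeg m) = k}"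
    and card_monomials_int: "card {m. int (mdeg m) = k} = dim_S k"
proof -
  have "{m. int (mdeg m) = k} = (if k < 0 then {} else {m. mdeg m = nat k})"
    by auto
  moreover have "nat k + 2 = nat (k + 2)" if "k \<ge> 0"
    using that by simp
  ultimately show "finite {m. int (mdeg m) = k}" "card {m. int (mdeg m) = k} = dim_S k"
    by (auto simp: dim_S_def finite_monomials card_monomials)
qed

text \<open>A graded piece of a free module whose generators may sit in different degrees;
  \<open>p\<close> lists the degrees left to the coefficients.\<close>

definition graded_vec :: "('n \<Rightarrow> int) \<Rightarrow> (poly3 ^ 'n) set" where
  "graded_vec p = {v. \<forall>i. v $ i \<in> S_comp (p i)}"

lemma S_comp_cscale: "p \<in> S_comp k \<Longrightarrow> cscale c p \<in> S_comp k"
  by (simp add: cscale_def S_comp_const_mult)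

lemma subspace_S_comp: "cspace.subspace (S_comp k)"
  by (auto simp: cspace.subspace_def S_comp_add S_comp_cscale)

lemma subspace_graded_vec: "vspace.subspace (graded_vec p)"
  by (auto simp: vspace.subspace_def graded_vec_def S_comp_add S_comp_cscale)

definition graded_vec_basis :: "('n::finite \<Rightarrow> int) \<Rightarrow> (poly3 ^ 'n) set" where
  "graded_vec_basis p = (\<lambda>(i, m). axis i (Poly_Mapping.single m 1)) ` (SIGMA i:UNIV. {m. int (mdeg m) = p i})"

lemma finite_graded_vec_basis: "finite (graded_vec_basis p)"
  by (simp add: graded_vec_basis_def finite_monomials_int)

lemma axis_single_eq_iff:
  "axis i (Poly_Mapping.single m (1::complex)) = axis j (Poly_Mapping.single n 1) \<longleftrightarrow> i = j \<and> m = n"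
proof -
  have "Poly_Mapping.single m (1::complex) = Poly_Mapping.single n 1 \<longleftrightarrow> m = n"
    by (metis keys_single singleton_inject zero_neq_one)
  moreover have "Poly_Mapping.single m (1::complex) \<noteq> 0"
    by (metis lookup_single_eq lookup_zero zero_neq_one)
  ultimately show ?thesis
    by (auto simp: axis_eq_axis)
qed

lemma card_graded_vec_basis: "card (graded_vec_basis p) = (\<Sum>i\<in>UNIV. dim_S (p i))"
  unfolding graded_vec_basis_def
  by (subst card_image) (auto simp: inj_on_def axis_single_eq_iff finite_monomials_int card_monomials_int)

lemma independent_graded_vec_basis: "vspace.independent (graded_vec_basis p)"
proof (rule vspace.independent_if_scalars_zero[OF finite_graded_vec_basis])
  fix c b assume sum0: "(\<Sum>x\<in>graded_vec_basis p. vscale (c x) x) = 0" and "b \<in> graded_vec_basis p"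
  then obtain i m where b: "b = axis i (Poly_Mapping.single m 1)"
    by (auto simp: graded_vec_basis_def)
  have "lkp (vscale (c x) x $ i) m = (if x = b then c b else 0)" if "x \<in> graded_vec_basis p" for x
    using that
  proof -
    assume "x \<in> graded_vec_basis p"
    then obtain j n where x: "x = axis j (Poly_Mapping.single n 1)"
      by (auto simp: graded_vec_basis_def)
    have "x = b \<longleftrightarrow> j = i \<and> n = m"
      by (simp add: x b axis_single_eq_iff)
    then show ?thesis
      by (auto simp: lookup_cscale x axis_def lookup_single when_def)
  qed
  then have "lkp ((\<Sum>x\<in>graded_vec_basis p. vscale (c x) x) $ i) m = (\<Sum>x\<in>graded_vec_basis p. if x = b then c b else 0)"
    unfolding sum_component lookup_sum by (rule sum.cong[OF refl])
  then show "c b = 0"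
    using \<open>b \<in> graded_vec_basis p\<close> finite_graded_vec_basis[of p] by (simp add: sum0)
qed

lemma graded_vec_basis_subset: "graded_vec_basis p \<subseteq> graded_vec p"
  by (auto simp: graded_vec_basis_def graded_vec_def axis_def S_comp_single)

lemma graded_vec_subset_span: "graded_vec p \<subseteq> vspace.span (graded_vec_basis p)"
proof
  fix v assume v: "v \<in> graded_vec p"
  have "v = (\<Sum>i\<in>UNIV. \<Sum>m\<in>Poly_Mapping.keys (v $ i). vscale (lkp (v $ i) m) (axis i (Poly_Mapping.single m 1)))"
  proof (rule vec_eq_iff[THEN iffD2], intro allI)
    fix j
    have "(\<Sum>i\<in>UNIV. \<Sum>m\<in>Poly_Mapping.keys (v $ i). vscale (lkp (v $ i) m) (axis i (Poly_Mapping.single m 1))) $ j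
      = (\<Sum>i\<in>UNIV. if i = j then \<Sum>m\<in>Poly_Mapping.keys (v $ i). Poly_Mapping.single m (lkp (v $ i) m) else 0)"
      unfolding sum_component
      by (rule sum.cong) (auto simp: axis_def cscale_def mult_single)
    also have "\<dots> = (\<Sum>m\<in>Poly_Mapping.keys (v $ j). Poly_Mapping.single m (lkp (v $ j) m))"
      by simp
    also have "\<dots> = v $ j"
      by (rule poly_mapping_sum_single[symmetric])
    finally show "v $ j = (\<Sum>i\<in>UNIV. \<Sum>m\<in>Poly_Mapping.keys (v $ i).
        vscale (lkp (v $ i) m) (axis i (Poly_Mapping.single m 1))) $ j" ..
  qed
  also have "\<dots> \<in> vspace.span (graded_vec_basis p)"
  proof (intro vspace.span_sum vspace.span_scale vspace.span_base)
    fix i m assume "m \<in> Poly_Mapping.keys (v $ i)"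
    then have "int (mdeg m) = p i"
      using v by (auto simp: graded_vec_def S_comp_def)
    then show "axis i (Poly_Mapping.single m 1) \<in> graded_vec_basis p"
      by (force simp: graded_vec_basis_def)
  qed
  finally show "v \<in> vspace.span (graded_vec_basis p)" .
qed

lemma dim_graded_vec: "vspace.dim (graded_vec p) = (\<Sum>i\<in>UNIV. dim_S (p i))"
  using vspace.dim_unique[OF graded_vec_basis_subset graded_vec_subset_span independent_graded_vec_basis refl] card_graded_vec_basis
  by metis

lemma S_comp_subset_span: "S_comp k \<subseteq> cspace.span ((\<lambda>m. Poly_Mapping.single m 1) ` {m. int (mdeg m) = k})"
proof
  fix p assume p: "p \<in> S_comp k"
  have "p = (\<Sum>m\<in>Poly_Mapping.keys p. cscale (lkp p m) (Poly_Mapping.single m 1))"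
    by (subst poly_mapping_sum_single) (simp add: cscale_def mult_single)
  also have "\<dots> \<in> cspace.span ((\<lambda>m. Poly_Mapping.single m 1) ` {m. int (mdeg m) = k})"
    using p by (intro cspace.span_sum cspace.span_scale cspace.span_base) (auto simp: S_comp_def)
  finally show "p \<in> cspace.span ((\<lambda>m. Poly_Mapping.single m 1) ` {m. int (mdeg m) = k})" .
qed

definition vcomb :: "('n::finite \<Rightarrow> poly3 ^ 'm) \<Rightarrow> poly3 ^ 'n \<Rightarrow> poly3 ^ 'm" where
  "vcomb R c = (\<Sum>i\<in>UNIV. c $ i *s R i)"

definition pcomb :: "('n::finite \<Rightarrow> poly3) \<Rightarrow> poly3 ^ 'n \<Rightarrow> poly3" where
  "pcomb P c = (\<Sum>i\<in>UNIV. c $ i * P i)"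

lemma linear_vcomb: "Vector_Spaces.linear vscale vscale (vcomb R)"
  by unfold_locales
    (simp_all add: vcomb_def vec_eq_iff distrib_right sum.distrib cscale_def sum_distrib_left mult.assoc)

lemma linear_pcomb: "Vector_Spaces.linear vscale cscale (pcomb P)"
  by unfold_locales
    (simp_all add: pcomb_def distrib_right sum.distrib cscale_def sum_distrib_left mult.assoc)

lemma dim_vcomb: "vspace.dim (vcomb R ` graded_vec q) + vspace.dim {c \<in> graded_vec q. vcomb R c = 0} = (\<Sum>i\<in>UNIV. dim_S (q i))"
  using vv.dim_image_add_dim_kernel[OF linear_vcomb subspace_graded_vec finite_graded_vec_basis graded_vec_subset_span]
  by (simp add: dim_graded_vec)

lemma dim_pcomb: "cspace.dim (pcomb P ` graded_vec q) + vspace.dim {c \<in> graded_vec q. pcomb P c = 0} = (\<Sum>i\<in>UNIV. dim_S (q i))"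
  using vc.dim_image_add_dim_kernel[OF linear_pcomb subspace_graded_vec finite_graded_vec_basis graded_vec_subset_span]
  by (simp add: dim_graded_vec)

text \<open>For a matrix with homogeneous entries, exactness over the whole ring restricts to every
  degree, since a preimage may be replaced by its homogeneous components.\<close>

lemma vcomb_graded:
  assumes R: "\<And>i j. R i $ j \<in> S_comp (p j - q i)"
  shows "graded_vec p \<inter> range (vcomb R) = vcomb R ` graded_vec q"
proof
  show "vcomb R ` graded_vec q \<subseteq> graded_vec p \<inter> range (vcomb R)"
  proof
    fix v assume "v \<in> vcomb R ` graded_vec q"
    then obtain c where c: "c \<in> graded_vec q" "v = vcomb R c" by blast
    have "c $ i * R i $ j \<in> S_comp (p j)" for i j
      using S_comp_mult[of "c $ i" "q i" "R i $ j" "p j - q i"] c(1) R by (simp add: graded_vec_def)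
    then have "v \<in> graded_vec p"
      by (auto simp: c(2) vcomb_def graded_vec_def intro!: S_comp_sum)
    then show "v \<in> graded_vec p \<inter> range (vcomb R)"
      using c(2) by blast
  qed
  show "graded_vec p \<inter> range (vcomb R) \<subseteq> vcomb R ` graded_vec q"
  proof
    fix v assume "v \<in> graded_vec p \<inter> range (vcomb R)"
    then obtain c where v: "v \<in> graded_vec p" and c: "v = vcomb R c" by blast
    define c' where "c' = (\<chi> i. hpart (q i) (c $ i))"
    have "v $ j = vcomb R c' $ j" for j
    proof -
      have "v $ j = hpart (p j) (v $ j)"
        using v hpart_S_comp[of "v $ j" "p j" "p j"] by (simp add: graded_vec_def)
      also have "\<dots> = (\<Sum>i\<in>UNIV. hpart (p j) (c $ i * R i $ j))"
        unfolding c by (simp add: vcomb_def hpart_sum)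
      also have "\<dots> = (\<Sum>i\<in>UNIV. hpart (q i) (c $ i) * R i $ j)"
        by (intro sum.cong refl) (simp add: hpart_mult[OF R])
      finally show ?thesis
        by (simp add: vcomb_def c'_def)
    qed
    then have "v = vcomb R c'"
      by (simp add: vec_eq_iff)
    moreover have "c' \<in> graded_vec q"
      by (simp add: c'_def graded_vec_def hpart_in_S_comp)
    ultimately show "v \<in> vcomb R ` graded_vec q"
      by blast
  qed
qed

lemma pcomb_graded:
  assumes P: "\<And>i. P i \<in> S_comp (k - q i)"
  shows "S_comp k \<inter> range (pcomb P) = pcomb P ` graded_vec q"
proof
  show "pcomb P ` graded_vec q \<subseteq> S_comp k \<inter> range (pcomb P)"
  proof
    fix v assume "v \<in> pcomb P ` graded_vec q"
    then obtain c where c: "c \<in> graded_vec q" "v = pcomb P c" by blast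
    have "c $ i * P i \<in> S_comp k" for i
      using S_comp_mult[of "c $ i" "q i" "P i" "k - q i"] c(1) P by (simp add: graded_vec_def)
    then have "v \<in> S_comp k"
      by (auto simp: c(2) pcomb_def intro!: S_comp_sum)
    then show "v \<in> S_comp k \<inter> range (pcomb P)"
      using c(2) by blast
  qed
  show "S_comp k \<inter> range (pcomb P) \<subseteq> pcomb P ` graded_vec q"
  proof
    fix v assume "v \<in> S_comp k \<inter> range (pcomb P)"
    then obtain c where v: "v \<in> S_comp k" and c: "v = pcomb P c" by blast
    define c' where "c' = (\<chi> i. hpart (q i) (c $ i))"
    have "v = hpart k v"
      using v hpart_S_comp[of v k k] by simp
    also have "\<dots> = (\<Sum>i\<in>UNIV. hpart k (c $ i * P i))"
      unfolding c by (simp add: pcomb_def hpart_sum)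
    also have "\<dots> = (\<Sum>i\<in>UNIV. hpart (q i) (c $ i) * P i)"
      by (intro sum.cong refl) (simp add: hpart_mult[OF P])
    finally have "v = pcomb P c'"
      by (simp add: pcomb_def c'_def)
    moreover have "c' \<in> graded_vec q"
      by (simp add: c'_def graded_vec_def hpart_in_S_comp)
    ultimately show "v \<in> pcomb P ` graded_vec q"
      by blast
  qed
qed

lemma (in module) span_image_finite:
  assumes "finite I"
  shows "span (f ` I) = range (\<lambda>c. \<Sum>i\<in>I. scale (c i) (f i))"
proof
  show "span (f ` I) \<subseteq> range (\<lambda>c. \<Sum>i\<in>I. scale (c i) (f i))" (is "_ \<subseteq> ?R")
  proof (rule span_minimal)
    show "f ` I \<subseteq> ?R"
    proof
      fix x assume "x \<in> f ` I"
      then obtain j where j: "j \<in> I" "x = f j" by blast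
      have "(\<Sum>i\<in>I. scale (if i = j then 1 else 0) (f i)) = (\<Sum>i\<in>I. if i = j then f j else 0)"
        by (rule sum.cong) auto
      also have "\<dots> = x"
        using j assms by simp
      finally show "x \<in> ?R"
        by (intro range_eqI[of _ _ "\<lambda>i. if i = j then 1 else 0"]) simp
    qed
    show "subspace ?R"
    proof (rule subspaceI)
      show "0 \<in> ?R"
        by (rule range_eqI[of _ _ "\<lambda>_. 0"]) simp
      show "x + y \<in> ?R" if x: "x \<in> ?R" and y: "y \<in> ?R" for x y
      proof -
        obtain c d where "x = (\<Sum>i\<in>I. scale (c i) (f i))" "y = (\<Sum>i\<in>I. scale (d i) (f i))"
          using x y by blast
        then show ?thesis
          by (intro range_eqI[of _ _ "\<lambda>i. c i + d i"]) (simp add: scale_left_distrib sum.distrib)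
      qed
      show "scale a x \<in> ?R" if x: "x \<in> ?R" for a x
      proof -
        obtain c where "x = (\<Sum>i\<in>I. scale (c i) (f i))"
          using x by blast
        then show ?thesis
          by (intro range_eqI[of _ _ "\<lambda>i. a * c i"]) (simp add: scale_sum_right)
      qed
    qed
  qed
  show "?R \<subseteq> span (f ` I)"
    by (intro image_subsetI span_sum span_scale span_base imageI)
qed

lemma (in vector_space) subspace_eq_if_dim_eq:
  assumes "subspace W" "W \<subseteq> V" "dim V = dim W" and fin: "finite A" "V \<subseteq> span A"
  shows "W = V"
proof -
  obtain C where C: "C \<subseteq> W" "independent C" "W \<subseteq> span C"
    using maximal_independent_subset by blast
  obtain B where B: "C \<subseteq> B" "B \<subseteq> V" "independent B" "V \<subseteq> span B"
    using maximal_independent_subset_extend[of C V] C assms(2) by blast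
  have "finite B"
    using independent_span_bound[OF fin(1) B(3)] B(2) fin(2) by blast
  moreover have "card C = card B"
    using dim_unique[OF C(1) C(3) C(2) refl] dim_unique[OF B(2) B(4) B(3) refl] assms(3) by simp
  ultimately have "C = B"
    using B(1) card_subset_eq by metis
  moreover have "span C \<subseteq> W"
    using span_minimal[OF C(1) assms(1)] .
  ultimately show ?thesis
    using B(4) assms(2) by blast
qed

text \<open>The bound is -2 because the quadratic vanishes at -2 and -1, where the component is zero
  too; doubling avoids a division.\<close>

lemma two_dim_S: "k \<ge> -2 \<Longrightarrow> 2 * int (dim_S k) = (k + 2) * (k + 1)"
proof -
  assume k: "k \<ge> -2"
  define n where "n = nat (k + 2)"
  have nk: "int n = k + 2"
    using k by (simp add: n_def)
  have "dim_S k = n choose 2"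
  proof (cases "k < 0")
    case True
    then have "n = 0 \<or> n = 1"
      using k unfolding n_def by linarith
    then show ?thesis
      using True by (auto simp: dim_S_def)
  qed (simp add: dim_S_def n_def)
  moreover have "2 * (n choose 2) = n * (n - 1)"
    unfolding choose_two by (rule dvd_mult_div_cancel) auto
  moreover have "int (n * (n - 1)) = int n * (int n - 1)"
    by (cases n) (simp_all add: algebra_simps)
  ultimately have "2 * int (dim_S k) = int n * (int n - 1)"
    by (metis of_nat_mult of_nat_numeral)
  then show ?thesis
    by (simp add: nk)
qed

lemma sum_option: "(\<Sum>x\<in>UNIV. g x) = g None + (\<Sum>i\<in>UNIV. g (Some i))"
  for g :: "'a::finite option \<Rightarrow> 'b::comm_monoid_add"
  by (simp add: UNIV_option_conv sum.reindex)

section \<open>Hilbert functions of J and J + (u)\<close>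

context three_syzygies_minors
begin

definition J :: "poly3 set" where "J = range (pcomb F)"

lemma J_iff: "g \<in> J \<longleftrightarrow> (\<exists>w. g = (\<Sum>i\<in>UNIV. w i * F i))"
  unfolding J_def pcomb_def
proof safe
  fix w :: "3 \<Rightarrow> poly3"
  show "(\<Sum>i\<in>UNIV. w i * F i) \<in> range (\<lambda>c. \<Sum>i\<in>UNIV. c $ i * F i)"
    by (rule range_eqI[of _ _ "\<chi> i. w i"]) simp
qed auto

lemma J_eq_ideal: "ideal_gen (range F) = J"
  unfolding ideal_gen_def module.span_image_finite[OF module_poly3 finite_class.finite_UNIV]
  by (auto simp: J_iff)

lemma J_subspace: "module.subspace (*) J"
  unfolding J_eq_ideal[symmetric] ideal_gen_def by (rule module.subspace_span[OF module_poly3])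

lemma J_mult: "g \<in> J \<Longrightarrow> q * g \<in> J"
  using module.subspace_scale[OF module_poly3 J_subspace] .

lemma J_add: "g \<in> J \<Longrightarrow> g' \<in> J \<Longrightarrow> g + g' \<in> J"
  using module.subspace_add[OF module_poly3 J_subspace] .

lemma J_sum: "(\<And>i. i \<in> X \<Longrightarrow> g i \<in> J) \<Longrightarrow> sum g X \<in> J"
  using module.subspace_sum[OF module_poly3 J_subspace] by blast

abbreviation "E \<equiv> \<Sum>i\<in>UNIV. \<delta> i"

text \<open>Rank-nullity along the resolution by \<open>h\<close>, \<open>r\<close> and
  \<open>F\<close>: generators in degree \<open>D\<close>, syzygies in degrees
  \<open>D + \<delta> i\<close>, one relation in degree \<open>E\<close>. Injectivity at the left
  end is \<open>h3_nonzero\<close>.\<close>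

lemma dim_J:
  "int (cspace.dim (S_comp k \<inter> J)) =
     3 * int (dim_S (k - D)) - (\<Sum>i\<in>UNIV. int (dim_S (k - D - \<delta> i))) + int (dim_S (k - E))"
proof -
  define H where "H = (\<lambda>_::1. \<chi> i. h i)"
  let ?q = "\<lambda>i. k - D - \<delta> i"
  have r_range: "w \<in> range (vcomb r) \<longleftrightarrow> (\<exists>c. w = (\<Sum>i\<in>UNIV. c i *s r i))" for w
  proof
    assume "\<exists>c. w = (\<Sum>i\<in>UNIV. c i *s r i)"
    then obtain c where "w = (\<Sum>i\<in>UNIV. c i *s r i)" by blast
    then show "w \<in> range (vcomb r)"
      by (intro range_eqI[of _ _ "\<chi> i. c i"]) (simp add: vcomb_def)
  qed (auto simp: vcomb_def)
  have "S_comp k \<inter> range (pcomb F) = pcomb F ` graded_vec (\<lambda>_. k - D)"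
    by (rule pcomb_graded) (simp add: F_deg)
  then have 1: "cspace.dim (S_comp k \<inter> J) + vspace.dim {w \<in> graded_vec (\<lambda>_. k - D). pcomb F w = 0} = 3 * dim_S (k - D)"
    using dim_pcomb[of F "\<lambda>_. k - D"] by (simp add: J_def)
  have "{w \<in> graded_vec (\<lambda>_. k - D). pcomb F w = 0} = graded_vec (\<lambda>_. k - D) \<inter> range (vcomb r)"
    unfolding pcomb_def r_generate r_range[symmetric] by blast
  also have "\<dots> = vcomb r ` graded_vec ?q"
    using r_deg by (intro vcomb_graded) (simp add: S3_comp_def)
  finally have 2: "vspace.dim {w \<in> graded_vec (\<lambda>_. k - D). pcomb F w = 0} + vspace.dim {c \<in> graded_vec ?q. vcomb r c = 0}
      = (\<Sum>i\<in>UNIV. dim_S (?q i))"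
    using dim_vcomb[of r ?q] by simp
  have "vcomb r c = 0 \<longleftrightarrow> c \<in> range (vcomb H)" for c
  proof
    assume "vcomb r c = 0"
    then obtain t where "\<And>i. c $ i = t * h i"
      unfolding vcomb_def using relation_multiple by blast
    then have "c = vcomb H (\<chi> _. t)"
      by (simp add: vcomb_def H_def vec_eq_iff)
    then show "c \<in> range (vcomb H)" by blast
  next
    assume "c \<in> range (vcomb H)"
    then obtain t :: "poly3 ^ 1" where "c = t $ 1 *s (\<chi> i. h i)"
      by (auto simp: vcomb_def H_def)
    then have "vcomb r c = t $ 1 *s (\<Sum>i\<in>UNIV. h i *s r i)"
      by (simp add: vcomb_def vec_eq_iff sum_3 algebra_simps)
    then show "vcomb r c = 0"
      by (simp add: h_relation)
  qed
  then have "{c \<in> graded_vec ?q. vcomb r c = 0} = graded_vec ?q \<inter> range (vcomb H)"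
    by blast
  also have "\<dots> = vcomb H ` graded_vec (\<lambda>_. k - E)"
  proof (rule vcomb_graded)
    fix i :: 1 and j
    have "k - D - \<delta> j - (k - E) = E - \<delta> j - D" by simp
    then show "H i $ j \<in> S_comp (k - D - \<delta> j - (k - E))"
      unfolding H_def using h_deg by simp
  qed
  finally have 3: "vspace.dim {c \<in> graded_vec ?q. vcomb r c = 0}
      + vspace.dim {c \<in> graded_vec (\<lambda>_::1. k - E). vcomb H c = 0} = dim_S (k - E)"
    using dim_vcomb[of H "\<lambda>_. k - E"] by simp
  have "{c \<in> graded_vec (\<lambda>_::1. k - E). vcomb H c = 0} = {0}"
  proof safe
    fix c assume "vcomb H c = 0"
    then have "c $ 1 * h 3 = 0"
      by (auto simp: vcomb_def H_def vec_eq_iff)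
    then show "c = 0"
      using h3_nonzero by (simp add: vec_eq_iff)
  qed (simp_all add: graded_vec_def vcomb_def)
  moreover have "vspace.dim {0 :: poly3 ^ 1} = 0"
    using vspace.dim_span[of "{}"] vspace.dim_eq_card_independent[OF vspace.independent_empty]
    by (metis card.empty vspace.span_empty)
  ultimately show ?thesis
    using 1 2 3 by (simp flip: of_nat_sum)
qed

text \<open>The index \<open>None\<close> adds \<open>u\<close> to \<open>F\<close> as a fourth
  generator, so that the dimension count for \<open>pcomb\<close> applies.\<close>

lemma Q_eq_range: "Q = range (pcomb (\<lambda>x. case x of None \<Rightarrow> u | Some i \<Rightarrow> F i))"
proof safe
  fix g assume "g \<in> Q"
  then obtain w s where "g = w 1 * F 1 + w 2 * F 2 + w (3::3) * F 3 + s * u"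
    unfolding Q_def by blast
  then show "g \<in> range (pcomb (\<lambda>x. case x of None \<Rightarrow> u | Some i \<Rightarrow> F i))"
    by (intro range_eqI[of _ _ "\<chi> x. case x of None \<Rightarrow> s | Some i \<Rightarrow> w i"])
      (simp add: pcomb_def sum_option sum_3)
next
  fix c :: "poly3 ^ 3 option"
  have "pcomb (\<lambda>x. case x of None \<Rightarrow> u | Some i \<Rightarrow> F i) c
     = c $ Some 1 * F 1 + c $ Some 2 * F 2 + c $ Some 3 * F 3 + c $ None * u"
    by (simp add: pcomb_def sum_option sum_3)
  then show "pcomb (\<lambda>x. case x of None \<Rightarrow> u | Some i \<Rightarrow> F i) c \<in> Q"
    unfolding Q_def by (intro CollectI exI[of _ "\<lambda>i. c $ Some i"] exI[of _ "c $ None"])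
qed

text \<open>Rank-nullity along the Hilbert-Burch resolution: the row \<open>(A i, - h i)\<close> is
  a syzygy in degree \<open>2 * D - \<delta> i\<close>, which for the curve is \<open>k_i\<close>,
  and injectivity comes from \<open>A_independent\<close>.\<close>

lemma dim_Q:
  "int (cspace.dim (S_comp k \<inter> Q)) =
     3 * int (dim_S (k - D)) + int (dim_S (k - (3 * D - E))) - (\<Sum>i\<in>UNIV. int (dim_S (k - (2 * D - \<delta> i))))"
proof -
  define P where "P = (\<lambda>x. case x of None \<Rightarrow> u | Some i \<Rightarrow> F i)"
  define Z where "Z = (\<lambda>i. \<chi> x. case x of None \<Rightarrow> - h i | Some j \<Rightarrow> A i $ j)"
  define p where "p = (\<lambda>x::3 option. case x of None \<Rightarrow> k - (3 * D - E) | Some _ \<Rightarrow> k - D)"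
  let ?q = "\<lambda>i. k - (2 * D - \<delta> i)"
  have "S_comp k \<inter> range (pcomb P) = pcomb P ` graded_vec p"
    by (rule pcomb_graded) (use F_deg u_deg in \<open>simp add: P_def p_def split: option.split\<close>)
  then have 1: "cspace.dim (S_comp k \<inter> Q) + vspace.dim {w \<in> graded_vec p. pcomb P w = 0}
      = 3 * dim_S (k - D) + dim_S (k - (3 * D - E))"
    using dim_pcomb[of P p] unfolding Q_eq_range P_def[symmetric]
    by (simp add: sum_option) (simp add: p_def)
  have vZ: "vcomb Z c $ None = - (c $ 1 * h 1 + c $ 2 * h 2 + c $ 3 * h 3)"
    "vcomb Z c $ Some l = c $ 1 * A 1 $ l + c $ 2 * A 2 $ l + c $ 3 * A 3 $ l" for c l
    by (simp_all add: vcomb_def Z_def sum_3)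
  have "pcomb P w = 0 \<longleftrightarrow> w \<in> range (vcomb Z)" for w
  proof
    assume "pcomb P w = 0"
    then have "w $ Some 1 * F 1 + w $ Some 2 * F 2 + w $ Some 3 * F 3 + w $ None * u = 0"
      by (simp add: pcomb_def P_def sum_option sum_3 add_ac)
    then obtain c where "\<forall>l. w $ Some l = c 1 * A 1 $ l + c 2 * A 2 $ l + c (3::3) * A 3 $ l"
      "w $ None = - (c 1 * h 1 + c 2 * h 2 + c 3 * h 3)"
      using extended_syzygy'[of "\<lambda>l. w $ Some l" "w $ None"] by blast
    then have "w $ x = vcomb Z (\<chi> i. c i) $ x" for x
      by (cases x) (simp_all add: vZ)
    then have "w = vcomb Z (\<chi> i. c i)"
      by (simp add: vec_eq_iff)
    then show "w \<in> range (vcomb Z)" by blast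
  next
    assume "w \<in> range (vcomb Z)"
    then obtain c where c: "w = vcomb Z c" by blast
    have "pcomb P w = c $ 1 * (A 1 $ 1 * F 1 + A 1 $ 2 * F 2 + A 1 $ 3 * F 3 - u * h 1)
      + c $ 2 * (A 2 $ 1 * F 1 + A 2 $ 2 * F 2 + A 2 $ 3 * F 3 - u * h 2)
      + c $ 3 * (A 3 $ 1 * F 1 + A 3 $ 2 * F 2 + A 3 $ 3 * F 3 - u * h 3)"
      by (simp add: c pcomb_def P_def sum_option sum_3 vZ algebra_simps)
    then show "pcomb P w = 0"
      unfolding u_h by simp
  qed
  then have "{w \<in> graded_vec p. pcomb P w = 0} = graded_vec p \<inter> range (vcomb Z)"
    by blast
  also have "\<dots> = vcomb Z ` graded_vec ?q"
  proof (rule vcomb_graded)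
    fix i x
    show "Z i $ x \<in> S_comp (p x - ?q i)"
    proof (cases x)
      case None
      have "k - (3 * D - E) - ?q i = E - \<delta> i - D" by simp
      then show ?thesis
        using h_deg[of i] by (simp add: None Z_def p_def S_comp_minus)
    next
      case (Some j)
      have "k - D - ?q i = D - \<delta> i" by simp
      then show ?thesis
        using A_deg[of i] by (simp add: Some Z_def p_def S3_comp_def)
    qed
  qed
  finally have 2: "vspace.dim {w \<in> graded_vec p. pcomb P w = 0} + vspace.dim {c \<in> graded_vec ?q. vcomb Z c = 0}
      = (\<Sum>i\<in>UNIV. dim_S (?q i))"
    using dim_vcomb[of Z ?q] by simp
  have "{c \<in> graded_vec ?q. vcomb Z c = 0} = {0}"
  proof safe
    fix c assume c: "vcomb Z c = 0"
    have "c $ 1 * A 1 $ l + c $ 2 * A 2 $ l + c $ 3 * A 3 $ l = 0" for l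
      using vZ(2)[of c l] by (simp add: c)
    then have "c $ i = 0" for i
      using A_independent[of "\<lambda>i. c $ i"] by blast
    then show "c = 0"
      by (simp add: vec_eq_iff)
  qed (simp_all add: graded_vec_def vcomb_def)
  moreover have "vspace.dim {0 :: poly3 ^ 3} = 0"
    using vspace.dim_span[of "{}"] vspace.dim_eq_card_independent[OF vspace.independent_empty]
    by (metis card.empty vspace.span_empty)
  ultimately show ?thesis
    using 1 2 by (simp flip: of_nat_sum)
qed

lemma J_subset_Q: "J \<subseteq> Q"
proof
  fix g assume "g \<in> J"
  then obtain w where "g = (\<Sum>i\<in>UNIV. w i * F i)"
    by (auto simp: J_iff)
  then have "g = w 1 * F 1 + w 2 * F 2 + w 3 * F 3 + 0 * u"
    by (simp add: sum_3)
  then show "g \<in> Q"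
    unfolding Q_def by blast
qed

lemma subspace_J: "cspace.subspace (S_comp k \<inter> J)"
  using J_add J_mult subspace_S_comp[of k] module.subspace_0[OF module_poly3 J_subspace]
  by (auto simp: cspace.subspace_def cscale_def)

lemma subspace_Q: "cspace.subspace (S_comp k \<inter> Q)"
proof -
  have "cspace.subspace Q"
    unfolding Q_eq_range using vc.linear_subspace_image[OF linear_pcomb vspace.subspace_UNIV] .
  then show ?thesis
    using subspace_S_comp cspace.subspace_inter by blast
qed

text \<open>In large degrees the Hilbert functions of \<open>Q\<close> and \<open>J\<close> agree, since their difference is a third
  difference of a quadratic polynomial. This replaces the Nullstellensatz for the ideal of the \<open>h i\<close>.\<close>

lemma u_multiple_in_J:
  obtains n where "\<And>p j. p \<in> S_comp j \<Longrightarrow> j \<ge> int n \<Longrightarrow> p * u \<in> J"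
proof
  \<comment> \<open>A generous bound that makes every degree to which \<open>two_dim_S\<close> is
    applied at least -2.\<close>
  let ?n = "nat (10 * \<bar>D\<bar> + 10 * \<bar>\<delta> 1\<bar> + 10 * \<bar>\<delta> 2\<bar> + 10 * \<bar>\<delta> 3\<bar>)"
  fix p j assume p: "p \<in> S_comp j" and j: "j \<ge> int ?n"
  define k where "k = j + (3 * D - E)"
  have ge: "10 * \<bar>D\<bar> + 10 * \<bar>\<delta> 1\<bar> + 10 * \<bar>\<delta> 2\<bar> + 10 * \<bar>\<delta> 3\<bar> \<le> k - (3 * D - (\<delta> 1 + \<delta> 2 + \<delta> 3))"
    using j by (simp add: k_def sum_3)
  have "int (cspace.dim (S_comp k \<inter> Q)) = int (cspace.dim (S_comp k \<inter> J))"
  proof -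
    have "2 * int (dim_S (k - (3 * D - (\<delta> 1 + \<delta> 2 + \<delta> 3)))) = (k - (3 * D - (\<delta> 1 + \<delta> 2 + \<delta> 3)) + 2) * (k - (3 * D - (\<delta> 1 + \<delta> 2 + \<delta> 3)) + 1)"
      "2 * int (dim_S (k - (2 * D - \<delta> 1))) = (k - (2 * D - \<delta> 1) + 2) * (k - (2 * D - \<delta> 1) + 1)"
      "2 * int (dim_S (k - (2 * D - \<delta> 2))) = (k - (2 * D - \<delta> 2) + 2) * (k - (2 * D - \<delta> 2) + 1)"
      "2 * int (dim_S (k - (2 * D - \<delta> 3))) = (k - (2 * D - \<delta> 3) + 2) * (k - (2 * D - \<delta> 3) + 1)"
      "2 * int (dim_S (k - D - \<delta> 1)) = (k - D - \<delta> 1 + 2) * (k - D - \<delta> 1 + 1)"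
      "2 * int (dim_S (k - D - \<delta> 2)) = (k - D - \<delta> 2 + 2) * (k - D - \<delta> 2 + 1)"
      "2 * int (dim_S (k - D - \<delta> 3)) = (k - D - \<delta> 3 + 2) * (k - D - \<delta> 3 + 1)"
      "2 * int (dim_S (k - (\<delta> 1 + \<delta> 2 + \<delta> 3))) = (k - (\<delta> 1 + \<delta> 2 + \<delta> 3) + 2) * (k - (\<delta> 1 + \<delta> 2 + \<delta> 3) + 1)"
      using ge by (intro two_dim_S; linarith)+
    then have "2 * (int (cspace.dim (S_comp k \<inter> Q)) - int (cspace.dim (S_comp k \<inter> J))) = 0"
      unfolding dim_Q dim_J sum_3 by (simp add: algebra_simps)
    then show ?thesis by simp
  qed
  then have "S_comp k \<inter> J = S_comp k \<inter> Q"
    using J_subset_Q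
    by (intro cspace.subspace_eq_if_dim_eq[OF subspace_J _ _ _ order_trans[OF Int_lower1 S_comp_subset_span]])
      (auto simp: finite_monomials_int)
  moreover have "p * u \<in> S_comp k"
    using S_comp_mult[OF p u_deg] by (simp add: k_def)
  moreover have "p * u \<in> Q"
    unfolding Q_def by (intro CollectI exI[of _ "\<lambda>_. 0"] exI[of _ p]) simp
  ultimately show "p * u \<in> J"
    by blast
qed

end

section \<open>The saturation of the Jacobian ideal\<close>

lemma ideal_gen_base: "a \<in> X \<Longrightarrow> a \<in> ideal_gen X"
  unfolding ideal_gen_def by (rule module.span_base[OF module_poly3])

lemma ideal_gen_minimal: "X \<subseteq> Y \<Longrightarrow> module.subspace (*) Y \<Longrightarrow> ideal_gen X \<subseteq> Y"
  unfolding ideal_gen_def by (rule module.span_minimal[OF module_poly3])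

lemma subspace_order_ge: "module.subspace (*) {q :: poly3. \<forall>m\<in>Poly_Mapping.keys q. n \<le> mdeg m}"
proof (rule module.subspaceI[OF module_poly3])
  fix p q :: poly3
  show "p + q \<in> {q. \<forall>m\<in>Poly_Mapping.keys q. n \<le> mdeg m}"
    if "p \<in> {q. \<forall>m\<in>Poly_Mapping.keys q. n \<le> mdeg m}" "q \<in> {q. \<forall>m\<in>Poly_Mapping.keys q. n \<le> mdeg m}"
    using that Poly_Mapping.keys_add[of p q] by blast
  show "p * q \<in> {q. \<forall>m\<in>Poly_Mapping.keys q. n \<le> mdeg m}"
    if "q \<in> {q. \<forall>m\<in>Poly_Mapping.keys q. n \<le> mdeg m}"
    using that Poly_Mapping.keys_mult[of p q] by (fastforce simp: mdeg_add)
qed simp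

text \<open>With \<open>u_multiple_in_J\<close>, this makes a high power of the maximal ideal
  multiply \<open>u\<close> into J, term by term.\<close>

lemma ideal_power_max_ideal_order:
  "ideal_power max_ideal n \<subseteq> {q. \<forall>m\<in>Poly_Mapping.keys q. n \<le> mdeg m}"
proof (induction n)
  case (Suc n)
  have max: "max_ideal \<subseteq> {q. \<forall>m\<in>Poly_Mapping.keys q. 1 \<le> mdeg m}"
    unfolding max_ideal_def
    by (rule ideal_gen_minimal[OF _ subspace_order_ge]) (auto simp: var3_def)
  have "a * b \<in> {q. \<forall>m\<in>Poly_Mapping.keys q. Suc n \<le> mdeg m}"
    if a: "a \<in> max_ideal" and b: "b \<in> ideal_power max_ideal n" for a b
  proof -
    have "1 \<le> mdeg m" if "m \<in> Poly_Mapping.keys a" for m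
      using a max that by blast
    moreover have "n \<le> mdeg m" if "m \<in> Poly_Mapping.keys b" for m
      using b Suc that by blast
    ultimately show ?thesis
      using Poly_Mapping.keys_mult[of a b] by (fastforce simp: mdeg_add)
  qed
  then show ?case
    unfolding ideal_power.simps ideal_mult_def
    by (intro ideal_gen_minimal[OF _ subspace_order_ge]) blast
qed simp

context three_syzygies_minors
begin

text \<open>For the first inclusion, membership in \<open>J\<close> is weakened to membership in
  \<open>Q\<close>; then \<open>Q_saturated\<close> lowers the exponent one at a time. For the
  second, only the multiple of \<open>u\<close> has to be brought into \<open>J\<close>.\<close>

lemma saturation_J: "saturation J = Q"
proof
  show "saturation J \<subseteq> Q"
  proof
    fix g assume "g \<in> saturation J"
    then obtain n where "\<forall>q\<in>ideal_power max_ideal n. q * g \<in> Q"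
      using J_subset_Q by (auto simp: saturation_def)
    then show "g \<in> Q"
    proof (induction n arbitrary: g)
      case 0
      then have "1 * g \<in> Q"
        by (auto simp del: mult_1_left)
      then show ?case by simp
    next
      case (Suc n)
      have "q * g \<in> Q" if q: "q \<in> ideal_power max_ideal n" for q
      proof (rule Q_saturated)
        fix i
        have "var3 i * q \<in> ideal_power max_ideal (Suc n)"
          using q by (auto simp: ideal_mult_def max_ideal_def intro!: ideal_gen_base)
        then have "var3 i * q * g \<in> Q"
          using Suc.prems by blast
        then show "var3 i * (q * g) \<in> Q"
          by (simp only: mult.assoc)
      qed
      then show ?case
        using Suc.IH by blast
    qed
  qed
  show "Q \<subseteq> saturation J"
  proof
    fix g assume "g \<in> Q"
    then obtain w s where g: "g = w 1 * F 1 + w 2 * F 2 + w (3::3) * F 3 + s * u"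
      unfolding Q_def by blast
    obtain n where n: "\<And>p j. p \<in> S_comp j \<Longrightarrow> j \<ge> int n \<Longrightarrow> p * u \<in> J"
      by (rule u_multiple_in_J) blast
    have "q * g \<in> J" if q: "q \<in> ideal_power max_ideal n" for q
    proof -
      have "(\<Sum>m\<in>Poly_Mapping.keys q. Poly_Mapping.single m (lkp q m) * u) \<in> J"
      proof (rule J_sum)
        fix m assume "m \<in> Poly_Mapping.keys q"
        then have "n \<le> mdeg m"
          using q ideal_power_max_ideal_order by blast
        then show "Poly_Mapping.single m (lkp q m) * u \<in> J"
          by (intro n[OF S_comp_single[OF refl]]) simp
      qed
      then have qu: "q * u \<in> J"
        by (simp flip: sum_distrib_right poly_mapping_sum_single)
      have "(\<Sum>i\<in>UNIV. w i * F i) \<in> J"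
        by (auto simp: J_iff)
      then have "q * (\<Sum>i\<in>UNIV. w i * F i) + s * (q * u) \<in> J"
        by (intro J_add J_mult qu)
      then show ?thesis
        by (simp add: g sum_3 algebra_simps)
    qed
    then show "g \<in> saturation J"
      unfolding saturation_def by blast
  qed
qed

text \<open>The twists by \<open>D\<close> cancel. With \<open>k_i = 2 * D - \<delta> i\<close> and
  \<open>\<sigma> = 3 * D - E\<close>, the twist \<open>D + \<delta> i\<close> is
  \<open>k_j + k_l - \<sigma>\<close> for the other two indices, and \<open>E\<close> is
  \<open>k_1 + k_2 + k_3 - 2 * \<sigma>\<close>, as in the Koszul complex of \<open>h\<close>
  shifted by \<open>\<sigma>\<close>.\<close>

lemma dim_saturation_quotient:
  "int (cspace.quotient_dim (saturation J \<inter> S_comp k) (J \<inter> S_comp k)) =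
     int (dim_S (k - (3 * D - E))) - (\<Sum>i\<in>UNIV. int (dim_S (k - (2 * D - \<delta> i))))
       + (\<Sum>i\<in>UNIV. int (dim_S (k - D - \<delta> i))) - int (dim_S (k - E))"
proof -
  have "cspace.quotient_dim (S_comp k \<inter> Q) (S_comp k \<inter> J) + cspace.dim (S_comp k \<inter> J)
      = cspace.dim (S_comp k \<inter> Q)"
    using J_subset_Q
    by (intro cspace.quotient_dim_add[OF subspace_Q subspace_J _ _ order_trans[OF Int_lower1 S_comp_subset_span]])
      (auto simp: finite_monomials_int)
  then have "int (cspace.quotient_dim (S_comp k \<inter> Q) (S_comp k \<inter> J)) =
      int (cspace.dim (S_comp k \<inter> Q)) - int (cspace.dim (S_comp k \<inter> J))"
    by linarith
  then show ?thesis
    by (simp add: saturation_J dim_Q dim_J Int_commute)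
qed

end

section \<open>From the curve to the algebraic setting, and the final count\<close>

lemma syzygy_curve_three_syzygies:
  assumes curve: "reduced_plane_curve d f" and exps: "syzygy_curve 3 [d1, d2, d3] f"
  defines "\<delta> \<equiv> \<lambda>i::3. if i = 1 then int d1 else if i = 2 then int d2 else int d3"
  obtains r where "three_syzygies (\<lambda>i. partial i f) r (int d - 1) \<delta>"
proof -
  obtain rs where len: "length rs = 3" and deg: "\<And>i. i < 3 \<Longrightarrow> rs ! i \<in> S3_comp (int ([d1, d2, d3] ! i))"
    and min: "minimally_generates rs (Syz f)"
    using exps unfolding syzygy_curve_def by blast
  \<comment> \<open>List positions start at 0, while the type \<open>3\<close> is enumerated as 1,
    2, 3 with \<open>3 = 0\<close>.\<close>
  define ix where "ix = (\<lambda>i::3. if i = 1 then 0 else if i = 2 then 1 else 2 :: nat)"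
  have ix: "ix 1 = 0" "ix 2 = 1" "ix 3 = 2"
    by (simp_all add: ix_def)
  have ix_less: "ix i < 3" for i
    by (simp add: ix_def)
  have ix_inj: "ix i = ix j \<longleftrightarrow> i = j" for i j
    using exhaust_3[of i] exhaust_3[of j] by (auto simp: ix)
  have ix_surj: "\<exists>i. k = ix i" if "k < 3" for k
    using that ix by (metis One_nat_def less_2_cases less_Suc_eq numeral_3_eq_3 numeral_2_eq_2)
  define r where "r = (\<lambda>i. rs ! ix i)"
  have sub: "{rs ! k |k. k < length rs \<and> k \<noteq> ix j} = r ` (UNIV - {j})" for j
    unfolding r_def len using ix_surj ix_less ix_inj by blast
  have set_rs: "set rs = range r"
    unfolding r_def set_conv_nth len using ix_surj ix_less by blast
  have span_r: "S3.span (r ` I) = range (\<lambda>c. \<Sum>i\<in>I. c i *s r i)" for I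
    by (rule S3.span_image_finite) simp
  have "three_syzygies (\<lambda>i. partial i f) r (int d - 1) \<delta>"
  proof
    show "partial i f \<in> S_comp (int d - 1)" for i
      using curve by (auto simp: reduced_plane_curve_def intro: partial_S_comp)
    show "p dvd 1" if "\<And>i. p dvd partial i f" for p
      using gradient_coprime[OF curve that] .
    show "r i \<in> S3_comp (\<delta> i)" for i
      using deg[OF ix_less[of i]] exhaust_3[of i] by (auto simp: r_def \<delta>_def ix)
    show "((\<Sum>i\<in>UNIV. w $ i * partial i f) = 0) = (\<exists>c. w = (\<Sum>i\<in>UNIV. c i *s r i))" for w
    proof -
      have "(\<Sum>i\<in>UNIV. w $ i * partial i f) = 0 \<longleftrightarrow> w \<in> S3.span (set rs)"
        using min by (simp add: minimally_generates_def Syz_def)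
      then show ?thesis
        unfolding set_rs span_r by blast
    qed
    \<comment> \<open>A unit coefficient puts \<open>r j\<close> into the span of the other two,
      which makes position \<open>ix j\<close> of the list redundant.\<close>
    show "\<not> c j dvd 1" if rel: "(\<Sum>i\<in>UNIV. c i *s r i) = 0" for c j
    proof
      assume "c j dvd 1"
      then obtain v where v: "1 = c j * v"
        by blast
      have "(\<Sum>i\<in>UNIV. c i *s r i) = c j *s r j + (\<Sum>i\<in>UNIV - {j}. c i *s r i)"
        by (rule sum.remove) simp_all
      then have "c j *s r j = - (\<Sum>i\<in>UNIV - {j}. c i *s r i)"
        using rel by (simp add: eq_neg_iff_add_eq_0)
      then have "c j *s r j \<in> S3.span (r ` (UNIV - {j}))"
        by (simp only:) (intro S3.span_neg S3.span_sum S3.span_scale S3.span_base imageI)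
      then have "v *s (c j *s r j) \<in> S3.span (r ` (UNIV - {j}))"
        by (rule S3.span_scale)
      moreover have "v *s (c j *s r j) = r j"
        unfolding vector_smult_assoc using v by (metis mult.commute vector_smult_lid)
      ultimately have "r j \<in> S3.span (r ` (UNIV - {j}))"
        by simp
      then have "range r \<subseteq> S3.span (r ` (UNIV - {j}))"
        by (metis (no_types, lifting) DiffI UNIV_I image_eqI image_subsetI singletonD S3.span_base)
      then have "S3.span (range r) \<subseteq> S3.span (r ` (UNIV - {j}))"
        by (rule S3.span_minimal[OF _ S3.subspace_span])
      moreover have "S3.span (r ` (UNIV - {j})) \<subseteq> S3.span (range r)"
        by (rule S3.span_mono) blast
      ultimately have "S3.span {rs ! k |k. k < length rs \<and> k \<noteq> ix j} = Syz f"
        using min unfolding sub minimally_generates_def set_rs by blast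
      then show False
        using min ix_less[of j] unfolding minimally_generates_def len by blast
    qed
  qed
  then show ?thesis
    using that by blast
qed

theorem theorem2p1:
  fixes f :: poly3 and d d1 d2 d3 :: nat and e k1 k2 k3 \<sigma> T0 :: int
  assumes curve: "reduced_plane_curve d f"
    and exps: "syzygy_curve 3 [d1, d2, d3] f"
    and not_pog: "\<not> plus_one_generated d f"
    and e: "e = int d1 + int d2 + int d3"
    and k1: "k1 = 2 * (int d - 1) - int d1"
    and k2: "k2 = 2 * (int d - 1) - int d2"
    and k3: "k3 = 2 * (int d - 1) - int d3"
    and \<sigma>: "\<sigma> = 3 * (int d - 1) - e"
    and T0: "T0 = (if real d1 \<ge> real d / 2 then k1 - 1 else int d + int d1 - 2)"
  shows "sigma_jac f = \<sigma> \<and>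
    (\<forall>k::int.
      (k < \<sigma> \<longrightarrow> n_jac f k = 0) \<and>
      (\<sigma> \<le> k \<and> k < k3 \<longrightarrow>
        int (n_jac f k) = int (nat (k - \<sigma> + 2) choose 2)) \<and>
      (k3 \<le> k \<and> k < k2 \<longrightarrow>
        int (n_jac f k) = int (nat (k - \<sigma> + 2) choose 2) - int (nat (k - k3 + 2) choose 2)) \<and>
      (k2 \<le> k \<and> k < T0 \<longrightarrow>
        int (n_jac f k) = int (nat (k - \<sigma> + 2) choose 2) - int (nat (k - k3 + 2) choose 2)
          - int (nat (k - k2 + 2) choose 2)))"
proof -
  define \<delta> where "\<delta> = (\<lambda>i::3. if i = 1 then int d1 else if i = 2 then int d2 else int d3)"
  have \<delta>: "\<delta> 1 = int d1" "\<delta> 2 = int d2" "\<delta> 3 = int d3"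
    by (simp_all add: \<delta>_def)
  obtain r where "three_syzygies (\<lambda>i. partial i f) r (int d - 1) \<delta>"
    using syzygy_curve_three_syzygies[OF curve exps] unfolding \<delta>_def by blast
  then obtain h A where "three_syzygies_minors (\<lambda>i. partial i f) r (int d - 1) \<delta> h A"
    by (rule three_syzygies.ex_minors)
  then interpret three_syzygies_minors "\<lambda>i. partial i f" r "int d - 1" \<delta> h A .
  have sorted: "int d1 \<le> int d2" "int d2 \<le> int d3"
    using exps by (auto simp: syzygy_curve_def)
  \<comment> \<open>The degree of \<open>h 3\<close> is \<open>d1 + d2 - (d - 1)\<close>, and it is
    at least 1.\<close>
  have pos: "int d1 + int d2 \<ge> int d"
    using h3_deg_pos by (simp add: \<delta>)
  have n: "int (n_jac f k) = int (dim_S (k - \<sigma>)) - int (dim_S (k - k1)) - int (dim_S (k - k2)) - int (dim_S (k - k3))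
      + int (dim_S (k - (int d - 1) - int d1)) + int (dim_S (k - (int d - 1) - int d2))
      + int (dim_S (k - (int d - 1) - int d3)) - int (dim_S (k - e))" for k
    unfolding n_jac_def jacobian_ideal_def J_eq_ideal dim_saturation_quotient
    by (simp add: sum_3 \<delta> \<sigma> k1 k2 k3 e)
  have H0: "dim_S j = 0" if "j < 0" for j
    using that by (simp add: dim_S_def)
  have H1: "dim_S j = nat (j + 2) choose 2" if "j \<ge> 0" for j
    using that by (simp add: dim_S_def)
  note defs = e k1 k2 k3 \<sigma>
  have low: "n_jac f k = 0" if "k < \<sigma>" for k
  proof -
    have "k - \<sigma> < 0" "k - k1 < 0" "k - k2 < 0" "k - k3 < 0" "k - (int d - 1) - int d1 < 0"
      "k - (int d - 1) - int d2 < 0" "k - (int d - 1) - int d3 < 0" "k - e < 0"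
      using that sorted pos unfolding defs right_diff_distrib by - linarith+
    then show ?thesis
      using n[of k] by (simp add: H0)
  qed
  \<comment> \<open>The terms of \<open>k3\<close>, \<open>k2\<close>, \<open>k1\<close> set in in
    this order by \<open>sorted\<close>. The twists \<open>d - 1 + d_i\<close> are not reached below
    \<open>k2\<close>, since \<open>d1 + d2 \<ge> d\<close> gives
    \<open>k2 < d - 1 + d1\<close>.\<close>
  have mid1: "int (n_jac f k) = int (nat (k - \<sigma> + 2) choose 2)" if "\<sigma> \<le> k" "k < k3" for k
  proof -
    have "k - \<sigma> \<ge> 0" "k - k1 < 0" "k - k2 < 0" "k - k3 < 0" "k - (int d - 1) - int d1 < 0"
      "k - (int d - 1) - int d2 < 0" "k - (int d - 1) - int d3 < 0" "k - e < 0"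
      using that sorted pos unfolding defs right_diff_distrib by - linarith+
    then show ?thesis
      using n[of k] by (simp add: H0 H1)
  qed
  have mid2: "int (n_jac f k) = int (nat (k - \<sigma> + 2) choose 2) - int (nat (k - k3 + 2) choose 2)"
    if "k3 \<le> k" "k < k2" for k
  proof -
    have "k - \<sigma> \<ge> 0" "k - k1 < 0" "k - k2 < 0" "k - k3 \<ge> 0" "k - (int d - 1) - int d1 < 0"
      "k - (int d - 1) - int d2 < 0" "k - (int d - 1) - int d3 < 0" "k - e < 0"
      using that sorted pos unfolding defs right_diff_distrib by - linarith+
    then show ?thesis
      using n[of k] by (simp add: H0 H1)
  qed
  have mid3: "int (n_jac f k) = int (nat (k - \<sigma> + 2) choose 2) - int (nat (k - k3 + 2) choose 2)
      - int (nat (k - k2 + 2) choose 2)" if "k2 \<le> k" "k < T0" for k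
  proof -
    \<comment> \<open>The next terms to set in are those of \<open>k1\<close> and
      \<open>d - 1 + d1\<close>. Their difference is \<open>d - 1 - 2 * d1\<close>, so the case
      distinction tells which comes first, and \<open>T0\<close> lies one below it.\<close>
    have "k < k1 \<and> k < int d - 1 + int d1"
    proof (cases "real d1 \<ge> real d / 2")
      case True
      then have "2 * int d1 \<ge> int d" by linarith
      then show ?thesis
        using that True by (simp add: T0 k1)
    next
      case False
      then have "2 * int d1 < int d" by linarith
      then show ?thesis
        using that False by (simp add: T0 k1)
    qed
    then have "k - \<sigma> \<ge> 0" "k - k1 < 0" "k - k2 \<ge> 0" "k - k3 \<ge> 0" "k - (int d - 1) - int d1 < 0"
      "k - (int d - 1) - int d2 < 0" "k - (int d - 1) - int d3 < 0" "k - e < 0"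
      using that sorted pos unfolding defs right_diff_distrib by - linarith+
    then show ?thesis
      using n[of k] by (simp add: H0 H1)
  qed
  have "sigma_jac f = \<sigma>"
    unfolding sigma_jac_def
  proof (rule Least_equality)
    \<comment> \<open>\<open>k3 > \<sigma>\<close> places \<open>\<sigma>\<close> in the second
      range, where the value is \<open>2 choose 2 = 1\<close>.\<close>
    have "k1 > \<sigma>" "k2 > \<sigma>" "k3 > \<sigma>"
      using sorted pos unfolding defs right_diff_distrib by - linarith+
    then show "n_jac f \<sigma> \<noteq> 0"
      using mid1[of \<sigma>] by simp
    show "\<sigma> \<le> k" if "n_jac f k \<noteq> 0" for k
      using that low[of k] by linarith
  qed
  then show ?thesis
    using low mid1 mid2 mid3 by blast
qed

end
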